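(* Let $p>3$ be a prime. In the polynomial ring $\mathbb{Z}_p[\beta]$, set $x=\beta(1-\beta)$ and $\alpha=1-\beta$. Then \[ \sum_{k=1}^{p-1}\binom{2k}{k}H_k^{(2)}x^k\equiv\frac{2\pounds_2(\alpha)-2\pounds_2(\beta)}{\beta-\alpha}\pmod{p}, \] \[ \sum_{k=1}^{p-1}C_kH_k^{(2)}x^{k+1}\equiv 2\alpha\pounds_2(\alpha)+2\beta\pounds_2(\beta)\pmod{p}. \]
   Context: $\mathbb{Z}_p$ denotes the ring of $p$-adic integers. For the fixed prime $p$, $\pounds_2(t)=\sum_{k=1}^{p-1}t^k/k^2$. $H_k^{(2)}=\sum_{j=1}^{k}1/j^2$ and $C_k=\frac{1}{k+1}\binom{2k}{k}$. Note $\pounds_2(\alpha)-\pounds_2(\beta)$ is divisible by $\alpha-\beta$ in $\mathbb{Z}_p[\beta]$. Congruence modulo $p$ means the difference lies in $p\,\mathbb{Z}_p[\beta]$. *)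

theory Defs
  imports "HOL-Computational_Algebra.Primes" "HOL-Number_Theory.Cong" "HOL-Algebra.UnivPoly"
begin

section \<open>The ring of \<open>p\<close>-adic integers\<close>

text \<open>
  \<open>\<int>\<^sub>p\<close> is the inverse limit of the rings \<open>\<int>/p\<^sup>n\<close>: an element is a coherent sequence of
  residues, the \<open>n\<close>-th one represented in \<open>{0..<p^n}\<close>, with componentwise operations.
  (The component at \<open>0\<close> is always \<open>0\<close>; \<open>residue_ring 1\<close> cannot serve here because
  its unit is not in its carrier.)
\<close>

definition padic_carrier :: "nat \<Rightarrow> (nat \<Rightarrow> int) set"
  where "padic_carrier p =
    {f. \<forall>n. f n \<in> {0..<int p ^ n} \<and> f (Suc n) mod int p ^ n = f n}"

definition padic_int :: "nat \<Rightarrow> (nat \<Rightarrow> int) ring"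
  where "padic_int p = \<lparr>
    carrier = padic_carrier p,
    mult = (\<lambda>f g n. (f n * g n) mod int p ^ n),
    one = (\<lambda>n. 1 mod int p ^ n),
    zero = (\<lambda>n. 0),
    add = (\<lambda>f g n. (f n + g n) mod int p ^ n)\<rparr>"

lemma padic_carrier_mod: "f \<in> padic_carrier p \<Longrightarrow> f n mod int p ^ n = f n"
  by (auto simp: padic_carrier_def)

lemma padic_carrier_modI:
  assumes "p > 0" and "\<And>n. [g (Suc n) = g n] (mod int p ^ n)"
  shows "(\<lambda>n. g n mod int p ^ n) \<in> padic_carrier p"
  using assms by (auto simp: padic_carrier_def cong_def mod_mod_cancel le_imp_power_dvd)

lemma padic_carrier_cong:
  "f \<in> padic_carrier p \<Longrightarrow> [f (Suc n) = f n] (mod int p ^ n)"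
  by (simp add: padic_carrier_def cong_def)

lemma zero_padic: "p > 0 \<Longrightarrow> (\<lambda>n. 0) \<in> padic_carrier p"
  by (simp add: padic_carrier_def)

lemma cring_padic_int:
  assumes p: "p > 0"
  shows "cring (padic_int p)"
proof (rule cringI)
  show "abelian_group (padic_int p)"
  proof (rule abelian_groupI)
    fix x assume x: "x \<in> carrier (padic_int p)"
    have "(\<lambda>n. (- x n) mod int p ^ n) \<in> padic_carrier p"
      using x by (intro padic_carrier_modI[OF p])
        (auto simp: padic_int_def cong_minus_minus_iff intro: padic_carrier_cong)
    then show "\<exists>y\<in>carrier (padic_int p). y \<oplus>\<^bsub>padic_int p\<^esub> x = \<zero>\<^bsub>padic_int p\<^esub>"
      by (intro bexI[of _ "\<lambda>n. (- x n) mod int p ^ n"])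
        (auto simp: padic_int_def mod_simps)
  qed (use p in \<open>auto simp: padic_int_def padic_carrier_mod zero_padic mod_simps add_ac
        intro!: padic_carrier_modI cong_add intro: padic_carrier_cong\<close>)
  show "comm_monoid (padic_int p)"
    by (rule comm_monoidI)
      (use p in \<open>auto simp: padic_int_def padic_carrier_mod mod_simps mult_ac
        intro!: padic_carrier_modI cong_mult intro: padic_carrier_cong\<close>)
qed (auto simp: padic_int_def mod_simps distrib_right)

section \<open>The polynomial ring \<open>\<int>\<^sub>p[\<beta>]\<close>\<close>

definition padic_poly :: "nat \<Rightarrow> (nat \<Rightarrow> int, nat \<Rightarrow> nat \<Rightarrow> int) up_ring"
  where "padic_poly p = UP (padic_int p)"

definition indet :: "nat \<Rightarrow> nat \<Rightarrow> nat \<Rightarrow> int"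
  where "indet p = monom (padic_poly p) \<one>\<^bsub>padic_int p\<^esub> 1"

lemma UP_cring_padic_int: "p > 0 \<Longrightarrow> UP_cring (padic_int p)"
  by (simp add: UP_cring_def cring_padic_int)

definition poly_cong :: "nat \<Rightarrow> (nat \<Rightarrow> nat \<Rightarrow> int) \<Rightarrow> (nat \<Rightarrow> nat \<Rightarrow> int) \<Rightarrow> bool"
  where "poly_cong p f g \<longleftrightarrow>
    f \<ominus>\<^bsub>padic_poly p\<^esub> g \<in> PIdl\<^bsub>padic_poly p\<^esub> ([p] \<cdot>\<^bsub>padic_poly p\<^esub> \<one>\<^bsub>padic_poly p\<^esub>)"

text \<open>
  The quotient \<open>a/b\<close> of ring elements; meaningful when \<open>b\<close> is a non-zero-divisor that divides \<open>a\<close>.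
\<close>

definition exact_quot :: "('a, 'm) ring_scheme \<Rightarrow> 'a \<Rightarrow> 'a \<Rightarrow> 'a"
  where "exact_quot R a b = (THE q. q \<in> carrier R \<and> q \<otimes>\<^bsub>R\<^esub> b = a)"

section \<open>The sums\<close>

text \<open>
  The fractions \<open>1/k\<^sup>2\<close> below are inverses in \<open>\<int>\<^sub>p\<close>, so they are meaningful only for \<open>k\<close>
  prime to \<open>p\<close>; in particular \<open>padic_harmonic2 p k\<close> is \<open>H\<^sub>k\<^sup>(\<^sup>2\<^sup>)\<close> only for \<open>k < p\<close>.
\<close>

definition inv_square :: "nat \<Rightarrow> nat \<Rightarrow> nat \<Rightarrow> int"
  where "inv_square p k = inv\<^bsub>padic_int p\<^esub> ([(k ^ 2)] \<cdot>\<^bsub>padic_int p\<^esub> \<one>\<^bsub>padic_int p\<^esub>)"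

definition padic_harmonic2 :: "nat \<Rightarrow> nat \<Rightarrow> nat \<Rightarrow> int"
  where "padic_harmonic2 p k = (\<Oplus>\<^bsub>padic_int p\<^esub>j\<in>{1..k}. inv_square p j)"

definition finite_polylog2 :: "nat \<Rightarrow> (nat \<Rightarrow> nat \<Rightarrow> int) \<Rightarrow> (nat \<Rightarrow> nat \<Rightarrow> int)"
  where "finite_polylog2 p t =
    (\<Oplus>\<^bsub>padic_poly p\<^esub>k\<in>{1..p-1}. inv_square p k \<odot>\<^bsub>padic_poly p\<^esub> (t [^]\<^bsub>padic_poly p\<^esub> k))"

text \<open>The division is exact.\<close>

definition catalan :: "nat \<Rightarrow> nat"
  where "catalan k = ((2 * k) choose k) div (k + 1)"

lemma unit_padic_of_nat:
  assumes p: "p > 0" and cop: "coprime k p"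
  shows "[k] \<cdot>\<^bsub>padic_int p\<^esub> \<one>\<^bsub>padic_int p\<^esub> \<in> Units (padic_int p)"
proof -
  interpret cring "padic_int p" by (rule cring_padic_int[OF p])
  have nat: "([k] \<cdot>\<^bsub>padic_int p\<^esub> \<one>\<^bsub>padic_int p\<^esub>) = (\<lambda>n. int k mod int p ^ n)"
  proof (induction k)
    case 0
    show ?case by (simp add: add.nat_pow_0) (simp add: padic_int_def)
  next
    case (Suc k)
    then show ?case by (simp add: add.nat_pow_Suc) (simp add: padic_int_def mod_simps add_ac)
  qed
  have "\<exists>y. [int k * y = 1] (mod int p ^ n)" for n
    using cop by (intro cong_solve_coprime_int) simp
  then obtain y where y: "\<And>n. [int k * y n = 1] (mod int p ^ n)" by metis
  have "[y (Suc n) = y n] (mod int p ^ n)" for n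
  proof -
    have "[int k * y (Suc n) = 1] (mod int p ^ n)"
      using y[of "Suc n"] by (rule cong_dvd_modulus) simp
    then have "[int k * y (Suc n) = int k * y n] (mod int p ^ n)"
      using y[of n] cong_trans cong_sym by blast
    then show ?thesis using cop by (simp add: cong_mult_lcancel)
  qed
  then have mem: "(\<lambda>n. y n mod int p ^ n) \<in> carrier (padic_int p)"
    using padic_carrier_modI[OF p] by (simp add: padic_int_def)
  have "(\<lambda>n. y n mod int p ^ n) \<otimes>\<^bsub>padic_int p\<^esub> ([k] \<cdot>\<^bsub>padic_int p\<^esub> \<one>\<^bsub>padic_int p\<^esub>) = \<one>\<^bsub>padic_int p\<^esub>"
    using y unfolding nat by (auto simp: padic_int_def cong_def mod_simps mult_ac)
  then show ?thesis
    using mem m_comm unfolding Units_def by (auto intro!: bexI[OF _ mem])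
qed

end

theory Submission
  imports Defs "HOL-Computational_Algebra.Polynomial" "HOL-Number_Theory.Residues"
    "HOL-Number_Theory.Modular_Inverse"
begin

text \<open>
  Modulo \<open>p\<close> both congruences are statements about integer polynomials in \<open>X\<close>. A polynomial of degree
  at most \<open>p\<close> vanishes modulo \<open>p\<close> as soon as its derivative and its coefficients at \<open>0\<close> and \<open>p\<close>
  do, so everything follows by differentiating with \<open>x = X (1 - X)\<close>, \<open>x' = 1 - 2 X\<close>, starting from
  \<open>\<Sum> (2k choose k) x\<^sup>k \<equiv> (1 - 4 x)\<^bsup>(p-1)/2\<^esup> = (1 - 2 X)\<^bsup>p-1\<^esup>\<close>. One integration gives
  \<open>\<Sum> (2k choose k) x\<^sup>k / k \<equiv> 2 \<pounds>\<^sub>1(X)\<close>, whence \<open>\<pounds>\<^sub>1(X) \<equiv> \<pounds>\<^sub>1(1 - X)\<close>; a second one gives the first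
  congruence multiplied by \<open>2 X - 1\<close>, and a third one the congruence with Catalan numbers. The degree
  bounds need \<open>H\<^bsub>(p-1)/2\<^esub>\<^sup>(\<^sup>2\<^sup>) \<equiv> H\<^bsub>p-1\<^esub>\<^sup>(\<^sup>2\<^sup>) \<equiv> 0\<close>, which is where \<open>p > 3\<close> enters.
\<close>

section \<open>Integer polynomials modulo \<open>p\<close>\<close>

text \<open>The coefficients stay integers instead of passing to the residue field, so that
  \<open>poly_cong_embed_poly\<close> can carry such a congruence into
  \<open>\<int>\<^sub>p[\<beta>]\<close> as it stands.\<close>

definition pcong :: "nat \<Rightarrow> int poly \<Rightarrow> int poly \<Rightarrow> bool"
  where "pcong p f g \<longleftrightarrow> of_nat p dvd f - g"

lemma pcong_refl [simp]: "pcong p f f"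
  by (simp add: pcong_def)

lemma pcong_sym: "pcong p f g \<Longrightarrow> pcong p g f"
  using dvd_minus_iff[of "of_nat p" "f - g"] by (simp add: pcong_def)

lemma pcong_trans [trans]: "pcong p f g \<Longrightarrow> pcong p g h \<Longrightarrow> pcong p f h"
  using dvd_add[of "of_nat p" "f - g" "g - h"] by (simp add: pcong_def)

lemma pcong_add: "pcong p f g \<Longrightarrow> pcong p f' g' \<Longrightarrow> pcong p (f + f') (g + g')"
  using dvd_add[of "of_nat p" "f - g" "f' - g'"] by (simp add: pcong_def algebra_simps)

lemma pcong_diff: "pcong p f g \<Longrightarrow> pcong p f' g' \<Longrightarrow> pcong p (f - f') (g - g')"
  using dvd_diff[of "of_nat p" "f - g" "f' - g'"] by (simp add: pcong_def algebra_simps)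

lemma pcong_mult:
  assumes "pcong p f g" "pcong p f' g'"
  shows "pcong p (f * f') (g * g')"
proof -
  have "f * f' - g * g' = (f - g) * f' + g * (f' - g')"
    by (simp add: algebra_simps)
  then show ?thesis
    using assms by (simp add: pcong_def)
qed

lemma pcong_sum: "(\<And>k. k \<in> S \<Longrightarrow> pcong p (f k) (g k)) \<Longrightarrow> pcong p (sum f S) (sum g S)"
  by (induction S rule: infinite_finite_induct) (auto intro: pcong_add)

lemma pcong_iff_coeff: "pcong p f g \<longleftrightarrow> (\<forall>n. int p dvd Polynomial.coeff (f - g) n)"
  by (simp add: pcong_def of_nat_poly const_poly_dvd_iff)

lemma pcong_of_int: "[a = b] (mod int p) \<Longrightarrow> pcong p (of_int a) (of_int b)"
  unfolding pcong_def of_int_diff [symmetric]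
  by (simp add: cong_iff_dvd_diff of_nat_poly of_int_poly)

lemma pcong_pderiv: "pcong p f g \<Longrightarrow> pcong p (pderiv f) (pderiv g)"
  by (auto simp: pcong_def pderiv_diff [symmetric] pderiv_mult elim!: dvdE)

lemma pcong_pcompose: "pcong p f g \<Longrightarrow> pcong p (pcompose f h) (pcompose g h)"
  unfolding pcong_def pcompose_diff [symmetric]
  by (erule dvdE) (simp add: pcompose_mult of_nat_poly del: mult_pCons_left)

lemma pderiv_of_int [simp]: "pderiv (of_int c) = 0"
  by (simp add: of_int_poly pderiv_pCons)

lemma pderiv_of_int_mult: "pderiv (of_int c * f) = of_int c * pderiv f"
  by (simp add: pderiv_mult)

lemma pderiv_sum: "pderiv (sum f S) = (\<Sum>k\<in>S. pderiv (f k))"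
  by (induction S rule: infinite_finite_induct) (simp_all add: pderiv_add)

text \<open>The extra factor \<open>y\<close> avoids the exponent k - 1: the operator y d/dy acts on
  each term by multiplying its coefficient by k. All derivatives below are taken in this form and
  the factor is cancelled at the end.\<close>

lemma mult_pderiv_sum_powers:
  "y * pderiv (\<Sum>k\<in>{1..n}. of_int (c k) * y ^ k) =
    (\<Sum>k\<in>{1..n}. of_int (c k * int k) * y ^ k) * pderiv y"
proof -
  have "y * pderiv (of_int (c k) * y ^ k) = of_int (c k * int k) * y ^ k * pderiv y"
    if "k \<in> {1..n}" for k
  proof (cases k)
    case (Suc j)
    have "y * pderiv (of_int (c k) * y ^ k) = of_int (c k) * of_nat (Suc j) * (y * y ^ j) * pderiv y"
      unfolding Suc pderiv_mult pderiv_power_Suc by (simp add: of_nat_poly algebra_simps)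
    then show ?thesis by (simp add: Suc)
  qed (use that in simp)
  then show ?thesis
    by (simp add: pderiv_sum sum_distrib_left sum_distrib_right)
qed

lemma degree_sum_powers_le:
  fixes y :: "int poly"
  assumes "degree y \<le> d"
  shows "degree (\<Sum>k\<in>{1..n}. of_int (c k) * y ^ k) \<le> n * d"
proof (rule degree_sum_le)
  fix k assume k: "k \<in> {1..n}"
  have "degree (of_int (c k) * y ^ k) \<le> degree (y ^ k)"
    using degree_mult_le[of "of_int (c k)" "y ^ k"] by simp
  also have "\<dots> \<le> d * k"
    using degree_power_le[of y k] assms mult_le_mono1 order_trans by blast
  also have "\<dots> \<le> n * d"
    using k by (simp add: mult.commute)
  finally show "degree (of_int (c k) * y ^ k) \<le> n * d" .
qed auto

definition X :: "int poly" where "X = [:0, 1:]"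

lemma degree_X [simp]: "degree X = 1"
  by (simp add: X_def)

lemma degree_1_minus_X [simp]: "degree (1 - X) = 1"
  by (simp add: X_def one_pCons)

lemma poly_X [simp]: "poly X c = c"
  by (simp add: X_def)

lemma pderiv_X [simp]: "pderiv X = 1"
  by (simp add: X_def pderiv_pCons)

lemma pcompose_X [simp]: "pcompose X f = f"
  by (simp add: X_def pcompose_pCons)

text \<open>The parameter \<open>m\<close> is (p - 1)/2, which is congruent to -1/2 modulo p. It is
  the exponent of 1 - 4 x and the last index at which \<open>cbinom\<close> is not divisible by
  p.\<close>

locale prime_gt_3 =
  fixes p m :: nat
  assumes prime_p: "prime p" and p_gt_3: "p > 3" and p_eq: "p = 2 * m + 1"
begin

abbreviation eqp (infix "\<simeq>" 50) where "f \<simeq> g \<equiv> pcong p f g"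

lemma coprime_p: "1 \<le> k \<Longrightarrow> k < p \<Longrightarrow> coprime (int k) (int p)"
  using prime_p by (metis coprime_commute coprime_int_iff nat_dvd_not_less
      not_one_le_zero order_less_le_trans prime_imp_coprime zero_less_one)

lemma p_dvd_mult_cancel:
  assumes "1 \<le> k" "k < p" "int p dvd int k * a"
  shows "int p dvd a"
proof -
  have "coprime (int p) (int k)"
    using coprime_p[OF assms(1,2)] by (rule coprime_imp_coprime) auto
  then show ?thesis
    using assms(3) by (simp only: coprime_dvd_mult_right_iff)
qed

text \<open>A prime number stays prime as a constant polynomial. The factors cancelled later are
  \<open>x\<close> and 2 X - 1.\<close>

lemma pcong_mult_cancel:
  assumes "h * f \<simeq> h * g" and "\<not> h \<simeq> 0"
  shows "f \<simeq> g"
proof -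
  have "prime_elem (of_nat p :: int poly)"
    using prime_p by (simp add: of_nat_poly prime_elem_const_poly_iff)
  then show ?thesis
    using assms by (simp add: pcong_def prime_elem_dvd_mult_iff flip: right_diff_distrib)
qed

lemma pcong_freshman: "(f + g) ^ p \<simeq> f ^ p + g ^ p"
proof -
  have "(f + g) ^ p = (\<Sum>k\<in>{..p}. of_nat (p choose k) * f ^ k * g ^ (p - k))"
    by (rule binomial_ring)
  also have "\<dots> \<simeq> (\<Sum>k\<in>{..p}. if k \<in> {0, p} then f ^ k * g ^ (p - k) else 0)"
  proof (rule pcong_sum)
    fix k assume k: "k \<in> {..p}"
    show "of_nat (p choose k) * f ^ k * g ^ (p - k) \<simeq> (if k \<in> {0, p} then f ^ k * g ^ (p - k) else 0)"
    proof (cases "k \<in> {0, p}")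
      case False
      then have "p dvd p choose k"
        using k prime_p by (intro dvd_choose_prime) auto
      then show ?thesis
        using False by (auto simp: pcong_def elim!: dvdE)
    qed auto
  qed
  also have "\<dots> = (\<Sum>k\<in>{0, p}. f ^ k * g ^ (p - k))"
    by (rule sum.mono_neutral_cong_right) auto
  also have "\<dots> = f ^ p + g ^ p"
    using p_gt_3 by (simp add: add.commute)
  finally show ?thesis .
qed

text \<open>The derivative carries the coefficient at n with the factor n, which is invertible
  modulo p for 0 < n < p. Up to degree p only the coefficients at 0 and p escape, and they are
  assumed separately.\<close>

lemma pcong_0I_pderiv:
  assumes f': "pderiv f \<simeq> 0" and f0: "int p dvd poly f 0"
    and deg: "degree f \<le> p" and fp: "int p dvd Polynomial.coeff f p"
  shows "f \<simeq> 0"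
proof -
  have "int p dvd Polynomial.coeff f n" for n
  proof (cases n)
    case 0
    then show ?thesis using f0 by (simp add: poly_0_coeff_0)
  next
    case (Suc k)
    consider "n < p" | "n = p" | "n > p" by linarith
    then show ?thesis
    proof cases
      case 1
      have "int p dvd int n * Polynomial.coeff f n"
        using f' unfolding Suc pcong_iff_coeff by (auto simp: coeff_pderiv)
      then show ?thesis
        using p_dvd_mult_cancel[of n "Polynomial.coeff f n"] 1 Suc by simp
    qed (use fp deg in \<open>auto simp: coeff_eq_0\<close>)
  qed
  then show ?thesis by (simp add: pcong_iff_coeff)
qed

section \<open>Inverses and harmonic numbers modulo p\<close>

definition inv_mod :: "nat \<Rightarrow> int" where "inv_mod k = int k ^ (p - 2)"

text \<open>This is Fermat's little theorem. With the inverse given as a power, harmonic sums become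
  power sums, and the effect of doubling or negating the index can be read off.\<close>

lemma inv_mod_inverse:
  assumes "1 \<le> k" "k < p"
  shows "[int k * inv_mod k = 1] (mod int p)"
proof -
  have "[k ^ (p - 1) = 1] (mod p)"
    using assms prime_p by (intro fermat_theorem) (auto dest: dvd_imp_le)
  then have "[int (k ^ (p - 1)) = int 1] (mod int p)"
    by (simp only: cong_int_iff)
  moreover have "int k * inv_mod k = int k ^ Suc (p - 2)"
    by (simp add: inv_mod_def)
  moreover have "Suc (p - 2) = p - 1" using p_gt_3 by simp
  ultimately show ?thesis by simp
qed

definition harmonic2 :: "nat \<Rightarrow> int" where "harmonic2 k = (\<Sum>j\<in>{1..k}. inv_mod j ^ 2)"

text \<open>
  Multiplication by \<open>2\<close> permutes the nonzero residues, so the sum \<open>S\<close> satisfies \<open>4 S \<equiv> S\<close>.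
\<close>

lemma harmonic2_p_minus_1: "[harmonic2 (p - 1) = 0] (mod int p)"
proof -
  define e where "e = (p - 2) * 2"
  define S where "S = (\<Sum>j\<in>{1..<int p}. j ^ e)"
  have "harmonic2 (p - 1) = (\<Sum>j\<in>{1..<p}. int j ^ e)"
    unfolding harmonic2_def inv_mod_def e_def by (rule sum.cong) (auto simp: power_mult)
  also have "\<dots> = (\<Sum>j\<in>int ` {1..<p}. j ^ e)"
    by (subst sum.reindex) auto
  finally have S_eq: "harmonic2 (p - 1) = S"
    by (simp add: S_def image_int_atLeastLessThan)
  have cop2: "coprime 2 (int p)"
    using coprime_p[of 2] p_gt_3 by simp
  have "S = (\<Sum>j\<in>{1..<int p}. (2 * j mod int p) ^ e)"
    unfolding S_def by (rule sum.reindex_bij_betw[OF bij_betw_int_remainders_mult[OF cop2], symmetric])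
  also have "[\<dots> = (\<Sum>j\<in>{1..<int p}. (2 * j) ^ e)] (mod int p)"
    by (intro cong_sum cong_pow) (simp add: cong_def)
  also have "(\<Sum>j\<in>{1..<int p}. (2 * j) ^ e) = 2 ^ e * S"
    by (simp add: S_def power_mult_distrib sum_distrib_left)
  \<comment> \<open>The factor 4 is there to meet \<open>2 ^ e\<close>: their product is the square
    of 2 times its inverse, hence 1 modulo p. What remains is 3 S, and 3 is invertible because p >
    3.\<close>
  finally have "[4 * S = 4 * (2 ^ e * S)] (mod int p)"
    by (intro cong_mult) auto
  also have "4 * (2 ^ e * S) = (int 2 * inv_mod 2) ^ 2 * S"
    by (simp add: inv_mod_def e_def power_mult power_mult_distrib)
  also have "[(int 2 * inv_mod 2) ^ 2 * S = 1 ^ 2 * S] (mod int p)"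
    using p_gt_3 by (intro cong_mult cong_pow inv_mod_inverse) auto
  finally have "int p dvd 3 * S"
    by (simp add: cong_iff_dvd_diff)
  then show ?thesis
    using p_dvd_mult_cancel[of 3 S] p_gt_3 S_eq by (simp add: cong_0_iff)
qed

text \<open>Squares of inverses do not change under j -> p - j, so the upper half of
  \<open>harmonic2 (p - 1)\<close> repeats the lower half. Twice the half sum is therefore 0 modulo
  p.\<close>

lemma harmonic2_m: "[harmonic2 m = 0] (mod int p)"
proof -
  have "(\<Sum>j\<in>{m+1..p-1}. inv_mod j ^ 2) = (\<Sum>j\<in>{1..m}. inv_mod (p - j) ^ 2)"
    by (rule sum.reindex_bij_witness[of _ "\<lambda>j. p - j" "\<lambda>j. p - j"]) (use p_eq in auto)
  also have "[\<dots> = (\<Sum>j\<in>{1..m}. inv_mod j ^ 2)] (mod int p)"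
  proof (rule cong_sum)
    fix j assume j: "j \<in> {1..m}"
    then have "[int (p - j) = - int j] (mod int p)"
      using p_eq by (simp add: cong_iff_dvd_diff of_nat_diff)
    then have "[inv_mod (p - j) ^ 2 = (- int j) ^ ((p - 2) * 2)] (mod int p)"
      unfolding inv_mod_def power_mult [symmetric] by (rule cong_pow)
    then show "[inv_mod (p - j) ^ 2 = inv_mod j ^ 2] (mod int p)"
      by (simp add: inv_mod_def power_mult [symmetric])
  qed
  finally have "[harmonic2 m + (\<Sum>j\<in>{m+1..p-1}. inv_mod j ^ 2) = harmonic2 m + harmonic2 m] (mod int p)"
    unfolding harmonic2_def by (intro cong_add) auto
  moreover have "harmonic2 m + (\<Sum>j\<in>{m+1..p-1}. inv_mod j ^ 2) = harmonic2 (p - 1)"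
    unfolding harmonic2_def using p_eq by (subst sum.union_disjoint [symmetric]) (auto intro!: sum.cong)
  ultimately have "[harmonic2 (p - 1) = 2 * harmonic2 m] (mod int p)" by simp
  then have "[2 * harmonic2 m = 0] (mod int p)"
    using harmonic2_p_minus_1 by (rule cong_trans[OF cong_sym])
  then show ?thesis
    using p_dvd_mult_cancel[of 2 "harmonic2 m"] p_gt_3 by (simp add: cong_0_iff)
qed

end

section \<open>Central binomial coefficients modulo p\<close>

definition cbinom :: "nat \<Rightarrow> int" where "cbinom k = int ((2 * k) choose k)"

lemma cbinom_0 [simp]: "cbinom 0 = 1"
  by (simp add: cbinom_def)

lemma cbinom_Suc: "int (Suc k) * cbinom (Suc k) = int (4 * k + 2) * cbinom k"
proof -
  have 1: "Suc k * (2 * Suc k choose Suc k) = Suc (Suc (2 * k)) * (Suc (2 * k) choose k)"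
    using Suc_times_binomial[of k "Suc (2 * k)"] by simp
  have 2: "Suc (2 * k) choose k = (Suc (2 * k) choose Suc k)"
    by (subst binomial_symmetric) auto
  have 3: "Suc k * (Suc (2 * k) choose Suc k) = Suc (2 * k) * (2 * k choose k)"
    by (rule Suc_times_binomial)
  have "Suc k * (Suc k * (2 * Suc k choose Suc k)) = Suc k * ((4 * k + 2) * (2 * k choose k))"
    unfolding 1 2 mult.left_commute[of "Suc k" "Suc (Suc (2 * k))"] 3 by (simp add: algebra_simps)
  then have "Suc k * (2 * Suc k choose Suc k) = (4 * k + 2) * (2 * k choose k)"
    by (simp only: mult_cancel1) simp
  then show ?thesis
    unfolding cbinom_def by (metis of_nat_mult)
qed

context prime_gt_3
begin

text \<open>Over the rationals the central binomial coefficient is (-4)^k times the binomial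
  coefficient of -1/2 over k, and -1/2 is congruent to m. The induction compares the two
  recurrences, whose factors 4 k + 2 and 4 k - 4 m differ by 2 p; dividing by \<open>Suc k\<close>
  is possible below p.\<close>

lemma cbinom_cong:
  assumes "k < p"
  shows "[cbinom k = int (m choose k) * (-4) ^ k] (mod int p)"
  using assms
proof (induction k)
  case (Suc k)
  have "int (Suc k) * int (m choose Suc k) = (int m - int k) * int (m choose k)"
  proof (cases "k \<le> m")
    case True
    have "Suc k * (m choose Suc k) = (m - k) * (m choose k)"
      by (simp only: binomial_absorption binomial_absorb_comp)
    then show ?thesis
      using True by (metis of_nat_diff of_nat_mult)
  qed (simp add: binomial_eq_0)
  then have 1: "int (Suc k) * (int (m choose Suc k) * (-4) ^ Suc k)
      = (4 * int k - 4 * int m) * (int (m choose k) * (-4) ^ k)"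
    by (simp only: power_Suc mult.assoc [symmetric]) (simp add: algebra_simps)
  have "[int (Suc k) * cbinom (Suc k) = int (4 * k + 2) * (int (m choose k) * (-4) ^ k)] (mod int p)"
    unfolding cbinom_Suc using Suc by (intro cong_mult) auto
  also have "[int (4 * k + 2) * (int (m choose k) * (-4) ^ k)
      = (4 * int k - 4 * int m) * (int (m choose k) * (-4) ^ k)] (mod int p)"
  proof (intro cong_mult cong_refl)
    have "int (4 * k + 2) - (4 * int k - 4 * int m) = int p * 2"
      by (simp add: p_eq)
    then show "[int (4 * k + 2) = 4 * int k - 4 * int m] (mod int p)"
      unfolding cong_iff_dvd_diff by (metis dvd_triv_left)
  qed
  also note 1 [symmetric]
  finally show ?case
    using coprime_p[of "Suc k"] Suc.prems by (subst (asm) cong_mult_lcancel) auto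
qed auto

text \<open>This cuts the sums at m, so that their degree 2 m in X stays below p.\<close>

lemma cbinom_dvd:
  assumes "m < k" "k < p"
  shows "int p dvd cbinom k"
  using cbinom_cong[OF assms(2)] assms(1) by (simp add: cong_0_iff binomial_eq_0)

section \<open>The congruences for integer polynomials\<close>


abbreviation x :: "int poly" where "x \<equiv> X * (1 - X)"

section \<open>Finite polylogarithms and their derivatives\<close>

definition polylog1 :: "int poly \<Rightarrow> int poly"
  where "polylog1 t = (\<Sum>k\<in>{1..p-1}. of_int (inv_mod k) * t ^ k)"

definition polylog2 :: "int poly \<Rightarrow> int poly"
  where "polylog2 t = (\<Sum>k\<in>{1..p-1}. of_int (inv_mod k ^ 2) * t ^ k)"

lemma mult_inv_mod_cong: "1 \<le> k \<Longrightarrow> k < p \<Longrightarrow> [c * inv_mod k * int k = c] (mod int p)"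
  using cong_mult[OF cong_refl[of c] inv_mod_inverse, of k] by (simp add: mult_ac)

lemma mult_pderiv_polylog1: "t * pderiv (polylog1 t) \<simeq> (\<Sum>k\<in>{1..p-1}. t ^ k) * pderiv t"
proof -
  have "(\<Sum>k\<in>{1..p-1}. of_int (inv_mod k * int k) * t ^ k) \<simeq> (\<Sum>k\<in>{1..p-1}. of_int 1 * t ^ k)"
  proof (intro pcong_sum pcong_mult pcong_of_int pcong_refl)
    fix k assume "k \<in> {1..p-1}"
    then show "[inv_mod k * int k = 1] (mod int p)"
      using mult_inv_mod_cong[of k 1] by auto
  qed
  then show ?thesis
    unfolding polylog1_def mult_pderiv_sum_powers by (intro pcong_mult) auto
qed

lemma mult_pderiv_polylog2: "t * pderiv (polylog2 t) \<simeq> polylog1 t * pderiv t"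
  unfolding polylog1_def polylog2_def mult_pderiv_sum_powers
proof (intro pcong_sum pcong_mult pcong_of_int pcong_refl)
  fix k assume "k \<in> {1..p-1}"
  then show "[inv_mod k ^ 2 * int k = inv_mod k] (mod int p)"
    using mult_inv_mod_cong[of k "inv_mod k"] by (auto simp: power2_eq_square)
qed

section \<open>The variable x and the generating functions of central binomial coefficients\<close>

lemma degree_x: "degree x \<le> 2"
  using degree_mult_le[of X "1 - X"] by simp

lemma pderiv_x: "pderiv x = 1 - 2 * X"
  by (simp add: pderiv_mult pderiv_diff algebra_simps)

lemma x_not_pcong_0: "\<not> x \<simeq> 0"
proof
  assume "x \<simeq> 0"
  then have "int p dvd Polynomial.coeff x 1"
    unfolding pcong_iff_coeff by (simp only: diff_0_right)
  then show False
    using p_gt_3 by (simp add: X_def one_pCons)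
qed

text \<open>By \<open>cbinom_cong\<close> the sum is (1 - 4 x)^m, and 1 - 4 x = (1 - 2 X)^2. One
  more factor 1 - 2 X completes the p-th power, which splits by \<open>pcong_freshman\<close>;
  Fermat's theorem replaces 2^p by 2.\<close>

lemma sum_cbinom_pcong:
  "(1 - 2 * X) * (\<Sum>k\<le>m. of_int (cbinom k) * x ^ k) \<simeq> 1 - 2 * X ^ p"
proof -
  have "(1 - 2 * X) ^ 2 = of_int (-4) * x + 1"
    by (simp add: power2_eq_square algebra_simps)
  then have "(1 - 2 * X) ^ p = (1 - 2 * X) * (of_int (-4) * x + 1) ^ m"
    by (simp add: p_eq power_mult)
  also have "(of_int (-4) * x + 1) ^ m = (\<Sum>k\<le>m. of_int (int (m choose k) * (-4) ^ k) * x ^ k)"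
    unfolding binomial_ring by (simp only: power_mult_distrib of_int_mult of_int_power
        of_int_of_nat_eq power_one mult_1_right mult.assoc)
  finally have eq: "(1 - 2 * X) ^ p = (1 - 2 * X) * (\<Sum>k\<le>m. of_int (int (m choose k) * (-4) ^ k) * x ^ k)" .
  have "(\<Sum>k\<le>m. of_int (cbinom k) * x ^ k)
      \<simeq> (\<Sum>k\<le>m. of_int (int (m choose k) * (-4) ^ k) * x ^ k)"
    using p_eq by (intro pcong_sum pcong_mult pcong_refl pcong_of_int cbinom_cong) auto
  then have "(1 - 2 * X) * (\<Sum>k\<le>m. of_int (cbinom k) * x ^ k) \<simeq> (1 - 2 * X) ^ p"
    unfolding eq by (rule pcong_mult[OF pcong_refl])
  also have "(1 - 2 * X) ^ p \<simeq> 1 - of_int (2 ^ p) * X ^ p"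
    using pcong_freshman[of 1 "- (2 * X)"] p_eq
    by (simp add: power_minus_odd power_mult_distrib mult_ac)
  also have "1 - of_int (2 ^ p) * X ^ p \<simeq> 1 - of_int 2 * X ^ p"
  proof (intro pcong_diff pcong_mult pcong_of_int pcong_refl)
    have "Suc (p - 1) = p" using p_gt_3 by simp
    moreover have "[2 * 2 ^ (p - 1) = 2 * 1] (mod p)"
      using p_gt_3 prime_p by (intro cong_mult fermat_theorem cong_refl) (auto dest: dvd_imp_le)
    ultimately have "[2 ^ p = 2] (mod p)"
      by (metis mult.right_neutral power_Suc)
    then have "[int (2 ^ p) = int 2] (mod int p)"
      by (simp only: cong_int_iff)
    then show "[2 ^ p = 2] (mod int p)" by simp
  qed
  finally show ?thesis by simp
qed

text \<open>After multiplication by x the derivatives of both sides agree by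
  \<open>sum_cbinom_pcong\<close> and the geometric sum. Both sides have degree at most p - 1 and
  vanish at 0, so nothing is to be checked at degree p.\<close>

lemma sum_cbinom_div_pcong:
  "(\<Sum>k\<in>{1..m}. of_int (cbinom k * inv_mod k) * x ^ k) \<simeq> 2 * polylog1 X" (is "?G \<simeq> _")
proof -
  define f where "f = ?G - 2 * polylog1 X"
  have G': "x * pderiv ?G \<simeq> (\<Sum>k\<in>{1..m}. of_int (cbinom k) * x ^ k) * (1 - 2 * X)"
    unfolding mult_pderiv_sum_powers pderiv_x
    by (intro pcong_mult pcong_sum pcong_of_int pcong_refl mult_inv_mod_cong) (use p_eq in auto)
  have 1: "(\<Sum>k\<in>{1..m}. of_int (cbinom k) * x ^ k) = (\<Sum>k\<le>m. of_int (cbinom k) * x ^ k) - 1"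
    by (simp add: atMost_atLeast0 sum.atLeast_Suc_atMost)
  have 2: "(1 - X) * (\<Sum>k\<in>{1..p-1}. X ^ k) = X - X ^ p"
    using sum_gp_multiplied[of 1 "p - 1" X] p_gt_3 by simp
  have "x * pderiv f = x * pderiv ?G - 2 * (1 - X) * (X * pderiv (polylog1 X))"
    by (simp add: f_def pderiv_diff pderiv_mult algebra_simps)
  also have "\<dots> \<simeq> (\<Sum>k\<in>{1..m}. of_int (cbinom k) * x ^ k) * (1 - 2 * X)
      - 2 * (1 - X) * ((\<Sum>k\<in>{1..p-1}. X ^ k) * pderiv X)"
    by (intro pcong_diff pcong_mult pcong_refl G' mult_pderiv_polylog1)
  also have "\<dots> = (1 - 2 * X) * (\<Sum>k\<le>m. of_int (cbinom k) * x ^ k) - (1 - 2 * X)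
      - 2 * ((1 - X) * (\<Sum>k\<in>{1..p-1}. X ^ k))"
    unfolding 1 by (simp add: algebra_simps)
  also have "\<dots> \<simeq> (1 - 2 * X ^ p) - (1 - 2 * X) - 2 * (X - X ^ p)"
    unfolding 2 by (intro pcong_diff pcong_refl sum_cbinom_pcong)
  also have "\<dots> = x * 0" by (simp add: algebra_simps)
  finally have "pderiv f \<simeq> 0"
    using x_not_pcong_0 by (rule pcong_mult_cancel)
  moreover have "degree f < p"
  proof -
    have "degree ?G \<le> m * 2" by (rule degree_sum_powers_le) (rule degree_x)
    moreover have "degree (2 * polylog1 X) \<le> p - 1"
      using degree_mult_le[of 2 "polylog1 X"] degree_sum_powers_le[of X 1 inv_mod "p - 1"]
      by (simp add: polylog1_def)
    ultimately have "degree f \<le> p - 1"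
      unfolding f_def by (intro degree_diff_le) (use p_eq in auto)
    then show ?thesis using p_gt_3 by simp
  qed
  moreover have "int p dvd poly f 0"
    by (simp add: f_def poly_sum polylog1_def power_0_left)
  ultimately have "f \<simeq> 0"
    by (simp add: pcong_0I_pderiv coeff_eq_0)
  then show ?thesis by (simp add: f_def pcong_def)
qed

lemma pcompose_x: "pcompose x (1 - X) = x"
  unfolding pcompose_mult pcompose_diff pcompose_1 pcompose_X by (simp add: algebra_simps)

lemma pcompose_sum_powers:
  "pcompose (\<Sum>k\<in>{1..n}. of_int (c k) * y ^ k) z = (\<Sum>k\<in>{1..n}. of_int (c k) * pcompose y z ^ k)"
proof -
  have "pcompose (y ^ k) z = pcompose y z ^ k" for k
    by (induction k) (simp_all add: pcompose_mult pcompose_1)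
  then show ?thesis
    by (simp add: pcompose_sum pcompose_mult of_int_poly pcompose_smult)
qed

text \<open>The sum depends on \<open>x\<close> only, which is invariant under \<open>X \<mapsto> 1 - X\<close>.\<close>

lemma sum_cbinom_div_pcong':
  "(\<Sum>k\<in>{1..m}. of_int (cbinom k * inv_mod k) * x ^ k) \<simeq> 2 * polylog1 (1 - X)"
proof -
  have "pcompose (\<Sum>k\<in>{1..m}. of_int (cbinom k * inv_mod k) * x ^ k) (1 - X) \<simeq> pcompose (2 * polylog1 X) (1 - X)"
    by (intro pcong_pcompose sum_cbinom_div_pcong)
  moreover have "pcompose (2 * polylog1 X) (1 - X) = 2 * polylog1 (1 - X)"
    unfolding polylog1_def pcompose_mult pcompose_sum_powers
    by (simp add: numeral_poly pcompose_pCons)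
  ultimately show ?thesis
    by (simp only: pcompose_sum_powers pcompose_x)
qed

lemma polylog1_1_minus: "2 * polylog1 (1 - X) \<simeq> 2 * polylog1 X"
  using sum_cbinom_div_pcong sum_cbinom_div_pcong' pcong_sym pcong_trans by blast

text \<open>At 0 the argument 1 - X is 1, and the finite dilogarithm at 1 is
  \<open>harmonic2 (p - 1)\<close>.\<close>

lemma poly_polylog2_1_minus: "int p dvd poly (polylog2 (1 - X)) 0"
  using harmonic2_p_minus_1 by (simp add: polylog2_def harmonic2_def poly_sum cong_0_iff)

lemma poly_polylog2_X: "poly (polylog2 X) 0 = 0"
  by (simp add: polylog2_def poly_sum power_0_left)

lemma degree_polylog2_le: "degree t \<le> 1 \<Longrightarrow> degree (polylog2 t) \<le> p - 1"
  unfolding polylog2_def using degree_sum_powers_le[of t 1 "\<lambda>k. inv_mod k ^ 2" "p - 1"] by simp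

section \<open>The first congruence, multiplied by 2 X - 1\<close>

definition harmonic_poly :: "int poly" where "harmonic_poly = (\<Sum>k\<in>{1..m}. of_int (cbinom k * harmonic2 k) * x ^ k)"

text \<open>The term at m drops by \<open>harmonic2_m\<close>. It would give degree p after
  multiplication by 2 X - 1, where the derivative no longer controls the coefficient; without it the
  degree stays below p.\<close>

lemma harmonic_poly_truncate: "harmonic_poly \<simeq> (\<Sum>k\<in>{1..m-1}. of_int (cbinom k * harmonic2 k) * x ^ k)"
proof -
  have "{1..m} = insert m {1..m-1}" "m \<notin> {1..m-1}"
    using p_eq p_gt_3 by auto
  then have "harmonic_poly = of_int (cbinom m * harmonic2 m) * x ^ m + (\<Sum>k\<in>{1..m-1}. of_int (cbinom k * harmonic2 k) * x ^ k)"
    by (simp add: harmonic_poly_def)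
  also have "\<dots> \<simeq> of_int 0 * x ^ m + (\<Sum>k\<in>{1..m-1}. of_int (cbinom k * harmonic2 k) * x ^ k)"
    using cong_mult[OF cong_refl harmonic2_m, of "cbinom m"]
    by (intro pcong_add pcong_mult pcong_of_int pcong_refl) auto
  finally show ?thesis by simp
qed

text \<open>The recurrence \<open>cbinom_Suc\<close>, read as a differential equation.\<close>

lemma mult_pderiv_harmonic_poly:
  "(1 - 2 * X) * (x * pderiv harmonic_poly) \<simeq> 2 * x * harmonic_poly + (\<Sum>k\<in>{1..m}. of_int (cbinom k * inv_mod k) * x ^ k)"
proof -
  define T where "T c = (\<Sum>k\<in>{1..m}. of_int (c k) * x ^ k)" for c :: "nat \<Rightarrow> int"
  \<comment> \<open>The factor x moves the power from k to k + 1, and \<open>cbinom_Suc\<close>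
    moves the binomial along with it, while the harmonic number keeps its old index.\<close>
  have shift: "x * (2 * harmonic_poly + 4 * T (\<lambda>k. cbinom k * harmonic2 k * int k))
      \<simeq> T (\<lambda>k. cbinom k * harmonic2 (k - 1) * int k)"
  proof -
    have "x * (2 * harmonic_poly + 4 * T (\<lambda>k. cbinom k * harmonic2 k * int k))
        = (\<Sum>k\<in>{1..m}. of_int (int (4 * k + 2) * cbinom k * harmonic2 k) * x ^ Suc k)"
      by (simp add: harmonic_poly_def T_def sum_distrib_left distrib_left algebra_simps flip: sum.distrib)
    also have "\<dots> = (\<Sum>k\<in>{1..m}. of_int (cbinom (Suc k) * harmonic2 k * int (Suc k)) * x ^ Suc k)"
      unfolding cbinom_Suc [symmetric] by (simp add: mult_ac)
    \<comment> \<open>The term for k = 0 can be added because \<open>harmonic2 0\<close> is 0. The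
      term for \<open>Suc m\<close> that the shift leaves at the top is dropped below, since p
      divides its binomial.\<close>
    also have "\<dots> = (\<Sum>k\<in>{0..m}. of_int (cbinom (Suc k) * harmonic2 k * int (Suc k)) * x ^ Suc k)"
      by (simp add: sum.atLeast_Suc_atMost[of 0] harmonic2_def)
    also have "\<dots> = (\<Sum>k\<in>{1..Suc m}. of_int (cbinom k * harmonic2 (k - 1) * int k) * x ^ k)"
      unfolding One_nat_def sum.shift_bounds_cl_Suc_ivl by simp
    also have "\<dots> = T (\<lambda>k. cbinom k * harmonic2 (k - 1) * int k)
        + of_int (cbinom (Suc m) * harmonic2 m * int (Suc m)) * x ^ Suc m"
      by (simp add: T_def)
    also have "\<dots> \<simeq> T (\<lambda>k. cbinom k * harmonic2 (k - 1) * int k) + of_int 0 * x ^ Suc m"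
      using p_eq p_gt_3 cbinom_dvd[of "Suc m"]
      by (intro pcong_add pcong_mult pcong_of_int pcong_refl) (auto simp: cong_0_iff)
    finally show ?thesis by simp
  qed
  have diff: "T (\<lambda>k. cbinom k * harmonic2 k * int k) - T (\<lambda>k. cbinom k * harmonic2 (k - 1) * int k)
      \<simeq> T (\<lambda>k. cbinom k * inv_mod k)"
  proof -
    have "T (\<lambda>k. cbinom k * harmonic2 k * int k) - T (\<lambda>k. cbinom k * harmonic2 (k - 1) * int k)
        = T (\<lambda>k. cbinom k * inv_mod k * inv_mod k * int k)"
      unfolding T_def sum_subtractf [symmetric]
    proof (intro sum.cong refl)
      fix k assume "k \<in> {1..m}"
      then have "{1..k} = insert k {1..k-1}" "k \<notin> {1..k-1}" by auto
      then have "harmonic2 k = inv_mod k ^ 2 + harmonic2 (k - 1)"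
        by (simp add: harmonic2_def)
      then show "of_int (cbinom k * harmonic2 k * int k) * x ^ k - of_int (cbinom k * harmonic2 (k - 1) * int k) * x ^ k
          = of_int (cbinom k * inv_mod k * inv_mod k * int k) * x ^ k"
        by (simp only: flip: left_diff_distrib of_int_diff) (simp add: algebra_simps power2_eq_square)
    qed
    also have "\<dots> \<simeq> T (\<lambda>k. cbinom k * inv_mod k)"
      unfolding T_def
      by (intro pcong_sum pcong_mult pcong_of_int pcong_refl mult_inv_mod_cong) (use p_eq in auto)
    finally show ?thesis .
  qed
  have A': "x * pderiv harmonic_poly = T (\<lambda>k. cbinom k * harmonic2 k * int k) * (1 - 2 * X)"
    unfolding harmonic_poly_def mult_pderiv_sum_powers pderiv_x T_def ..
  \<comment> \<open>Here (1 - 2 X)^2 = 1 - 4 x is used.\<close>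
  have "(1 - 2 * X) * (x * pderiv harmonic_poly) = 2 * x * harmonic_poly + (T (\<lambda>k. cbinom k * harmonic2 k * int k)
      - x * (2 * harmonic_poly + 4 * T (\<lambda>k. cbinom k * harmonic2 k * int k)))"
    unfolding A' by (simp add: algebra_simps)
  also have "\<dots> \<simeq> 2 * x * harmonic_poly + (T (\<lambda>k. cbinom k * harmonic2 k * int k) - T (\<lambda>k. cbinom k * harmonic2 (k - 1) * int k))"
    by (intro pcong_add pcong_diff pcong_refl shift)
  also have "\<dots> \<simeq> 2 * x * harmonic_poly + T (\<lambda>k. cbinom k * inv_mod k)"
    by (intro pcong_add pcong_refl diff)
  finally show ?thesis by (simp add: T_def)
qed

text \<open>The factor 2 X - 1 is an integrating factor for
  \<open>mult_pderiv_harmonic_poly\<close>: x times the derivative of its product with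
  \<open>harmonic_poly\<close> is congruent to \<open>- ?G\<close>, and the same holds for the
  dilogarithm side.\<close>

lemma harmonic_poly_polylog: "(2 * X - 1) * harmonic_poly \<simeq> 2 * (polylog2 (1 - X) - polylog2 X)"
proof -
  let ?A = "\<Sum>k\<in>{1..m-1}. of_int (cbinom k * harmonic2 k) * x ^ k"
  let ?G = "\<Sum>k\<in>{1..m}. of_int (cbinom k * inv_mod k) * x ^ k"
  define R where "R = 2 * (polylog2 (1 - X) - polylog2 X)"
  \<comment> \<open>\<open>?A\<close> replaces \<open>harmonic_poly\<close> for the sake of the
    degree; the derivative is computed with \<open>harmonic_poly\<close>, to which it is
    congruent.\<close>
  define f where "f = (2 * X - 1) * ?A - R"
  have f: "f \<simeq> (2 * X - 1) * harmonic_poly - R"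
    unfolding f_def by (intro pcong_diff pcong_mult pcong_refl pcong_sym[OF harmonic_poly_truncate])
  have R': "x * pderiv R \<simeq> - ?G"
  proof -
    have "x * pderiv R = 2 * (X * ((1 - X) * pderiv (polylog2 (1 - X))) - (1 - X) * (X * pderiv (polylog2 X)))"
      by (simp add: R_def pderiv_diff pderiv_mult algebra_simps)
    also have "\<dots> \<simeq> 2 * (X * (polylog1 (1 - X) * pderiv (1 - X)) - (1 - X) * (polylog1 X * pderiv X))"
      by (intro pcong_diff pcong_mult pcong_refl mult_pderiv_polylog2)
    also have "\<dots> = 0 - X * (2 * polylog1 (1 - X)) - (1 - X) * (2 * polylog1 X)"
      by (simp add: pderiv_diff algebra_simps)
    \<comment> \<open>The weights X and 1 - X add up to 1, so together they leave one copy of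
      \<open>?G\<close>.\<close>
    also have "\<dots> \<simeq> 0 - X * ?G - (1 - X) * ?G"
      by (intro pcong_diff pcong_mult pcong_refl pcong_sym[OF sum_cbinom_div_pcong]
          pcong_sym[OF sum_cbinom_div_pcong'])
    also have "\<dots> = - ?G" by (simp add: algebra_simps)
    finally show ?thesis .
  qed
  have "x * pderiv f \<simeq> x * pderiv ((2 * X - 1) * harmonic_poly - R)"
    by (intro pcong_mult pcong_refl pcong_pderiv f)
  also have "x * pderiv ((2 * X - 1) * harmonic_poly - R)
      = 2 * x * harmonic_poly - (1 - 2 * X) * (x * pderiv harmonic_poly) - x * pderiv R"
    unfolding pderiv_diff pderiv_mult by (simp add: algebra_simps)
  also have "\<dots> \<simeq> 2 * x * harmonic_poly - (2 * x * harmonic_poly + ?G) - (- ?G)"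
    by (intro pcong_diff pcong_refl mult_pderiv_harmonic_poly R')
  also have "\<dots> = x * 0" by simp
  finally have "pderiv f \<simeq> 0"
    using x_not_pcong_0 by (rule pcong_mult_cancel)
  moreover have "degree f < p"
  proof -
    have "degree ?A \<le> (m - 1) * 2" by (rule degree_sum_powers_le) (rule degree_x)
    moreover have "degree (2 * X - 1) \<le> 1"
      by (simp add: X_def numeral_poly one_pCons)
    ultimately have "degree ((2 * X - 1) * ?A) \<le> p - 1"
      using degree_mult_le[of "2 * X - 1" ?A] p_eq p_gt_3 by linarith
    moreover have "degree R \<le> p - 1"
    proof -
      have "degree (polylog2 (1 - X) - polylog2 X) \<le> p - 1"
        by (intro degree_diff_le degree_polylog2_le) simp_all
      then show ?thesis
        using degree_mult_le[of 2 "polylog2 (1 - X) - polylog2 X"] by (simp add: R_def)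
    qed
    ultimately have "degree f \<le> p - 1"
      unfolding f_def by (rule degree_diff_le)
    then show ?thesis using p_gt_3 by simp
  qed
  moreover have "int p dvd poly f 0"
    using poly_polylog2_1_minus by (simp add: f_def R_def poly_sum poly_polylog2_X power_0_left)
  ultimately have "f \<simeq> 0"
    by (simp add: pcong_0I_pderiv coeff_eq_0)
  then have "(2 * X - 1) * harmonic_poly - R \<simeq> 0"
    using f pcong_sym pcong_trans by blast
  then show ?thesis by (simp add: R_def pcong_def)
qed

section \<open>Catalan numbers and the second congruence\<close>

lemma catalan_Suc: "int (Suc k) * int (catalan k) = cbinom k"
proof -
  have "Suc k dvd (2 * k choose k)"
  proof -
    \<comment> \<open>Neighbouring binomials show that k + 1 divides k times the central one, and k
      + 1 is coprime to k. So the division in \<open>catalan\<close> is exact.\<close>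
    have "Suc k * (2 * k choose Suc k) = k * (2 * k choose k)"
      by (simp only: binomial_absorption binomial_absorb_comp [symmetric]) simp
    then have "Suc k dvd k * (2 * k choose k)" by (metis dvd_triv_left)
    then show ?thesis
      by (simp add: coprime_dvd_mult_right_iff)
  qed
  then have "Suc k * catalan k = (2 * k choose k)"
    unfolding catalan_def Suc_eq_plus1 by (rule dvd_mult_div_cancel)
  then show ?thesis
    unfolding cbinom_def by (metis of_nat_mult)
qed

text \<open>The sum stops at m - 1 so that the degree is at most 2 m = p - 1;
  \<open>catalan_poly_extend\<close> restores the full range.\<close>

definition catalan_poly :: "int poly" where "catalan_poly = (\<Sum>k\<in>{1..m-1}. of_int (int (catalan k) * harmonic2 k) * x ^ (k + 1))"

text \<open>Differentiating the power k + 1 of x brings down k + 1, which turns the Catalan number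
  into the central binomial coefficient.\<close>

lemma pderiv_catalan_poly: "pderiv catalan_poly \<simeq> (1 - 2 * X) * harmonic_poly"
proof -
  have "pderiv (of_int (int (catalan k) * harmonic2 k) * x ^ (k + 1))
      = (1 - 2 * X) * (of_int (cbinom k * harmonic2 k) * x ^ k)" for k
  proof -
    have "pderiv (of_int (int (catalan k) * harmonic2 k) * x ^ (k + 1))
        = of_int (int (catalan k) * harmonic2 k) * (of_nat (Suc k) * x ^ k * (1 - 2 * X))"
      by (simp only: Suc_eq_plus1 [symmetric] pderiv_of_int_mult pderiv_power_Suc pderiv_x)
        (simp add: of_nat_poly)
    also have "\<dots> = (1 - 2 * X) * (of_int (int (Suc k) * int (catalan k) * harmonic2 k) * x ^ k)"
      by (simp add: mult_ac)
    finally show ?thesis by (simp only: catalan_Suc)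
  qed
  then have "pderiv catalan_poly = (1 - 2 * X) * (\<Sum>k\<in>{1..m-1}. of_int (cbinom k * harmonic2 k) * x ^ k)"
    by (simp only: catalan_poly_def pderiv_sum sum_distrib_left)
  also have "\<dots> \<simeq> (1 - 2 * X) * harmonic_poly"
    by (intro pcong_mult pcong_refl pcong_sym[OF harmonic_poly_truncate])
  finally show ?thesis .
qed

text \<open>In the derivative of the difference the dilogarithms cancel against
  \<open>pderiv_catalan_poly\<close> by \<open>harmonic_poly_polylog\<close>; what is left vanishes
  by the symmetry \<open>polylog1_1_minus\<close>. Here the degree reaches p, so the coefficient at
  p needs its own argument.\<close>

lemma catalan_poly_polylog: "catalan_poly \<simeq> 2 * ((1 - X) * polylog2 (1 - X)) + 2 * (X * polylog2 X)"
proof -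
  define R where "R = 2 * ((1 - X) * polylog2 (1 - X)) + 2 * (X * polylog2 X)"
  define f where "f = catalan_poly - R"
  have "pderiv f = pderiv catalan_poly + 2 * (polylog2 (1 - X) - polylog2 X)
      - 2 * ((1 - X) * pderiv (polylog2 (1 - X)) + X * pderiv (polylog2 X))"
    unfolding f_def R_def pderiv_diff pderiv_add pderiv_mult by (simp add: algebra_simps)
  also have "\<dots> \<simeq> (1 - 2 * X) * harmonic_poly + (2 * X - 1) * harmonic_poly
      - 2 * (polylog1 (1 - X) * pderiv (1 - X) + polylog1 X * pderiv X)"
    by (intro pcong_diff pcong_add pcong_mult pcong_refl mult_pderiv_polylog2 pderiv_catalan_poly pcong_sym[OF harmonic_poly_polylog])
  also have "\<dots> = 2 * polylog1 (1 - X) - 2 * polylog1 X"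
    by (simp add: pderiv_diff algebra_simps)
  also have "\<dots> \<simeq> 2 * polylog1 X - 2 * polylog1 X"
    by (intro pcong_diff pcong_refl polylog1_1_minus)
  finally have 1: "pderiv f \<simeq> 0" by simp
  have 2: "int p dvd poly f 0"
    using poly_polylog2_1_minus by (simp add: f_def R_def catalan_poly_def poly_sum)
  have "degree catalan_poly \<le> p - 1"
    unfolding catalan_poly_def
  proof (rule degree_sum_le)
    fix k assume k: "k \<in> {1..m-1}"
    have "degree (of_int (int (catalan k) * harmonic2 k) * x ^ (k + 1)) \<le> degree (x ^ (k + 1))"
      using degree_mult_le[of "of_int (int (catalan k) * harmonic2 k)" "x ^ (k + 1)"] by (simp only: degree_of_int add_0)
    also have "\<dots> \<le> 2 * (k + 1)"
      using degree_power_le[of x "k + 1"] degree_x mult_le_mono1 order_trans by blast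
    also have "\<dots> \<le> p - 1" using k p_eq by auto
    finally show "degree (of_int (int (catalan k) * harmonic2 k) * x ^ (k + 1)) \<le> p - 1" .
  qed auto
  have t: "degree (t * polylog2 t) \<le> p" if "degree t \<le> 1" for t
    using degree_mult_le[of t "polylog2 t"] degree_polylog2_le[OF that] that p_gt_3 by linarith
  have "degree R \<le> p"
    unfolding R_def using t[of X] t[of "1 - X"]
      degree_mult_le[of 2 "(1 - X) * polylog2 (1 - X)"] degree_mult_le[of 2 "X * polylog2 X"]
    by (intro degree_add_le) simp_all
  then have 3: "degree f \<le> p"
    unfolding f_def using \<open>degree catalan_poly \<le> p - 1\<close> by (intro degree_diff_le) auto
  have 4: "int p dvd Polynomial.coeff f p"
  proof -
    \<comment> \<open>Only the summand k = p - 1 reaches degree p. Its coefficient is the same for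
      both arguments, and the p-th powers of X and 1 - X have opposite leading coefficients modulo
      p.\<close>
    have c: "Polynomial.coeff (t * polylog2 t) p = inv_mod (p - 1) ^ 2 * Polynomial.coeff (t ^ p) p" if "degree t \<le> 1" for t
    proof -
      have "t * polylog2 t = (\<Sum>k\<in>{1..p-1}. of_int (inv_mod k ^ 2) * t ^ Suc k)"
        by (simp add: polylog2_def sum_distrib_left mult_ac)
      then have "Polynomial.coeff (t * polylog2 t) p = (\<Sum>k\<in>{1..p-1}. inv_mod k ^ 2 * Polynomial.coeff (t ^ Suc k) p)"
        by (simp add: coeff_sum of_int_poly)
      also have "\<dots> = (\<Sum>k\<in>{p-1}. inv_mod k ^ 2 * Polynomial.coeff (t ^ Suc k) p)"
      proof (rule sum.mono_neutral_right)
        show "\<forall>k\<in>{1..p-1} - {p-1}. inv_mod k ^ 2 * Polynomial.coeff (t ^ Suc k) p = 0"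
        proof
          fix k assume "k \<in> {1..p-1} - {p-1}"
          moreover have "degree (t ^ Suc k) \<le> 1 * Suc k"
            using degree_power_le mult_le_mono1[OF that] by (rule order_trans)
          ultimately show "inv_mod k ^ 2 * Polynomial.coeff (t ^ Suc k) p = 0"
            by (subst coeff_eq_0) auto
        qed
      qed (use p_gt_3 in auto)
      finally show ?thesis using p_gt_3 by simp
    qed
    have "(1 - X) ^ p \<simeq> 1 - X ^ p"
      using pcong_freshman[of 1 "- X"] p_eq by (simp add: power_minus_odd)
    then have "int p dvd Polynomial.coeff ((1 - X) ^ p - (1 - X ^ p)) p"
      by (simp only: pcong_iff_coeff)
    moreover have "Polynomial.coeff (1 - X ^ p) p = - Polynomial.coeff (X ^ p) p"
      using p_gt_3 by simp
    ultimately have "int p dvd Polynomial.coeff ((1 - X) ^ p) p + Polynomial.coeff (X ^ p) p"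
      by simp
    moreover have "Polynomial.coeff R p
        = 2 * inv_mod (p - 1) ^ 2 * (Polynomial.coeff ((1 - X) ^ p) p + Polynomial.coeff (X ^ p) p)"
    proof -
      have "Polynomial.coeff (2 * g) p = 2 * Polynomial.coeff g p" for g :: "int poly"
        by (simp add: numeral_poly)
      then have "Polynomial.coeff R p
          = 2 * Polynomial.coeff ((1 - X) * polylog2 (1 - X)) p + 2 * Polynomial.coeff (X * polylog2 X) p"
        by (simp only: R_def coeff_add)
      also have "\<dots> = 2 * (inv_mod (p - 1) ^ 2 * Polynomial.coeff ((1 - X) ^ p) p)
          + 2 * (inv_mod (p - 1) ^ 2 * Polynomial.coeff (X ^ p) p)"
        by (simp only: c degree_X degree_1_minus_X order_refl)
      finally show ?thesis by (simp only: distrib_left mult.assoc)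
    qed
    moreover have "Polynomial.coeff catalan_poly p = 0"
      using \<open>degree catalan_poly \<le> p - 1\<close> p_gt_3 by (intro coeff_eq_0) simp
    ultimately show ?thesis
      by (simp add: f_def)
  qed
  from 1 2 3 4 have "f \<simeq> 0" by (rule pcong_0I_pderiv)
  then show ?thesis by (simp add: f_def R_def pcong_def)
qed

section \<open>Division by 2 X - 1 and the full range of summation\<close>

text \<open>The quotient \<open>2 (\<alpha>\<^sup>k - \<beta>\<^sup>k) / (\<beta> - \<alpha>)\<close>.\<close>

definition diff_quot :: "nat \<Rightarrow> int poly"
  where "diff_quot k = - 2 * (\<Sum>i<k. (1 - X) ^ (k - Suc i) * X ^ i)"

lemma diff_quot_mult: "diff_quot k * (2 * X - 1) = 2 * (1 - X) ^ k - 2 * X ^ k"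
proof -
  have "X ^ k - (1 - X) ^ k = (2 * X - 1) * (\<Sum>i<k. (1 - X) ^ (k - Suc i) * X ^ i)"
    using power_diff_sumr2[of X k "1 - X"] by simp
  then show ?thesis by (simp add: diff_quot_def algebra_simps)
qed

text \<open>Cancels 2 X - 1 in \<open>harmonic_poly_polylog\<close>; it is nonzero modulo p because
  its constant term is -1. The right-hand side is written with the same \<open>diff_quot\<close> as
  the exact quotient in \<open>exact_quot_polylog\<close>.\<close>

lemma harmonic_poly_quotient:
  "pcong p harmonic_poly (\<Sum>k\<in>{1..p-1}. of_int (inv_mod k ^ 2) * diff_quot k)" (is "pcong p harmonic_poly ?Q")
proof (rule pcong_mult_cancel)
  have "(2 * X - 1) * ?Q = (\<Sum>k\<in>{1..p-1}. of_int (inv_mod k ^ 2) * (2 * (1 - X) ^ k - 2 * X ^ k))"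
    unfolding diff_quot_mult [symmetric] sum_distrib_left by (simp only: mult_ac)
  also have "\<dots> = 2 * (polylog2 (1 - X) - polylog2 X)"
    unfolding polylog2_def sum_subtractf [symmetric] sum_distrib_left by (simp only: algebra_simps)
  finally show "pcong p ((2 * X - 1) * harmonic_poly) ((2 * X - 1) * ?Q)"
    using harmonic_poly_polylog by simp
  show "\<not> pcong p (2 * X - 1) 0"
  proof
    assume "pcong p (2 * X - 1) 0"
    then have "int p dvd Polynomial.coeff (2 * X - 1) 0"
      by (simp only: pcong_iff_coeff diff_0_right)
    then show False
      using p_gt_3 by (simp add: X_def)
  qed
qed

lemma harmonic_poly_extend: "pcong p (\<Sum>k\<in>{1..p-1}. of_int (cbinom k * harmonic2 k) * x ^ k) harmonic_poly"
proof -
  have "{1..p-1} = {1..m} \<union> {m+1..p-1}" "{1..m} \<inter> {m+1..p-1} = {}"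
    using p_eq by auto
  then have "(\<Sum>k\<in>{1..p-1}. of_int (cbinom k * harmonic2 k) * x ^ k)
      = harmonic_poly + (\<Sum>k\<in>{m+1..p-1}. of_int (cbinom k * harmonic2 k) * x ^ k)"
    by (simp add: harmonic_poly_def sum.union_disjoint)
  also have "pcong p \<dots> (harmonic_poly + (\<Sum>k\<in>{m+1..p-1}. of_int 0 * x ^ k))"
    using cbinom_dvd p_gt_3
    by (intro pcong_add pcong_sum pcong_mult pcong_of_int pcong_refl) (auto simp: cong_0_iff)
  finally show ?thesis by simp
qed

text \<open>Between m and p - 1 the Catalan number inherits the factor p of the central binomial,
  since k + 1 is prime to p. At k = p - 1 this fails because k + 1 = p; there, as at k = m, the
  harmonic number vanishes instead.\<close>

lemma catalan_poly_extend: "pcong p (\<Sum>k\<in>{1..p-1}. of_int (int (catalan k) * harmonic2 k) * x ^ (k + 1)) catalan_poly"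
proof -
  have "{1..p-1} = {1..m-1} \<union> {m..p-1}" "{1..m-1} \<inter> {m..p-1} = {}"
    using p_eq p_gt_3 by auto
  then have "(\<Sum>k\<in>{1..p-1}. of_int (int (catalan k) * harmonic2 k) * x ^ (k + 1))
      = catalan_poly + (\<Sum>k\<in>{m..p-1}. of_int (int (catalan k) * harmonic2 k) * x ^ (k + 1))"
    by (simp only: catalan_poly_def sum.union_disjoint finite_atLeastAtMost)
  also have "pcong p \<dots> (catalan_poly + (\<Sum>k\<in>{m..p-1}. of_int 0 * x ^ (k + 1)))"
  proof (intro pcong_add pcong_sum pcong_mult pcong_of_int pcong_refl)
    fix k assume k: "k \<in> {m..p-1}"
    consider "k = m" | "k = p - 1" | "m < k" "Suc k < p" using k by fastforce
    then show "[int (catalan k) * harmonic2 k = 0] (mod int p)"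
    proof cases
      case 3
      then have "int p dvd int (Suc k) * int (catalan k)"
        using cbinom_dvd[of k] by (simp only: catalan_Suc)
      then show ?thesis
        using 3 p_dvd_mult_cancel[of "Suc k" "int (catalan k)"] by (simp add: cong_0_iff)
    qed (use cong_mult[OF cong_refl harmonic2_m] cong_mult[OF cong_refl harmonic2_p_minus_1] in auto)
  qed
  finally show ?thesis by simp
qed

end

section \<open>Embedding integer polynomials into \<open>\<int>\<^sub>p[\<beta>]\<close>\<close>

locale padic_polys =
  fixes p :: nat
  assumes p_pos: "p > 0"
begin

abbreviation "R \<equiv> padic_int p"
abbreviation "P \<equiv> padic_poly p"

end

sublocale padic_polys \<subseteq> UP_cring "padic_int p" "padic_poly p"
  using UP_cring_padic_int[OF p_pos] by (simp_all add: padic_poly_def UP_cring_def UP_def)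

context padic_polys
begin

definition embed :: "int \<Rightarrow> nat \<Rightarrow> int"
  where "embed c = (\<lambda>n. c mod int p ^ n)"

lemma embed_closed [simp]: "embed c \<in> carrier R"
  using padic_carrier_modI[OF p_pos, of "\<lambda>_. c"] by (simp add: embed_def padic_int_def)

lemma embed_0: "embed 0 = \<zero>\<^bsub>R\<^esub>"
  by (simp add: embed_def padic_int_def)

lemma embed_1: "embed 1 = \<one>\<^bsub>R\<^esub>"
  by (simp add: embed_def padic_int_def)

lemma embed_add: "embed (a + b) = embed a \<oplus>\<^bsub>R\<^esub> embed b"
  by (simp add: embed_def padic_int_def mod_simps)

lemma embed_mult: "embed (a * b) = embed a \<otimes>\<^bsub>R\<^esub> embed b"
  by (simp add: embed_def padic_int_def mod_simps)

lemma embed_sum: "finite S \<Longrightarrow> embed (sum f S) = (\<Oplus>\<^bsub>R\<^esub>k\<in>S. embed (f k))"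
  by (induction S rule: finite_induct) (simp_all add: embed_0 embed_add)

lemma embed_of_nat: "[k] \<cdot>\<^bsub>R\<^esub> \<one>\<^bsub>R\<^esub> = embed (int k)"
  by (induction k)
    (simp_all add: R.add.nat_pow_0 R.add.nat_pow_Suc embed_0 embed_1 embed_add R.a_comm)

definition embed_poly :: "int poly \<Rightarrow> nat \<Rightarrow> nat \<Rightarrow> int"
  where "embed_poly f = (\<lambda>n. embed (Polynomial.coeff f n))"

lemma embed_poly_closed [simp]: "embed_poly f \<in> carrier P"
proof -
  have "bound \<zero>\<^bsub>R\<^esub> (degree f) (embed_poly f)"
    by (rule bound.intro) (simp add: embed_poly_def coeff_eq_0 embed_0)
  then have "embed_poly f \<in> up R"
    by (intro mem_upI) (auto simp: embed_poly_def)
  then show ?thesis by (simp add: padic_poly_def UP_def)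
qed

lemma coeff_embed_poly [simp]: "UnivPoly.coeff P (embed_poly f) n = embed (Polynomial.coeff f n)"
  using embed_poly_closed[of f] by (simp add: padic_poly_def UP_def) (simp add: embed_poly_def)

lemma embed_poly_0: "embed_poly 0 = \<zero>\<^bsub>P\<^esub>"
  by (rule up_eqI) (simp_all add: embed_0)

lemma embed_poly_1: "embed_poly 1 = \<one>\<^bsub>P\<^esub>"
  by (rule up_eqI) (simp_all add: embed_0 embed_1)

lemma embed_poly_add: "embed_poly (f + g) = embed_poly f \<oplus>\<^bsub>P\<^esub> embed_poly g"
  by (rule up_eqI) (simp_all add: embed_add)

lemma embed_poly_mult: "embed_poly (f * g) = embed_poly f \<otimes>\<^bsub>P\<^esub> embed_poly g"
  by (rule up_eqI) (simp_all add: Polynomial.coeff_mult embed_sum embed_mult)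

lemma embed_poly_diff: "embed_poly (f - g) = embed_poly f \<ominus>\<^bsub>P\<^esub> embed_poly g"
proof -
  have "embed_poly f = embed_poly (f - g) \<oplus>\<^bsub>P\<^esub> embed_poly g"
    by (simp flip: embed_poly_add)
  then show ?thesis
    by (simp add: a_minus_def P.a_assoc P.r_neg)
qed

lemma embed_poly_power: "embed_poly (f ^ k) = embed_poly f [^]\<^bsub>P\<^esub> k"
  by (induction k) (simp_all add: embed_poly_1 embed_poly_mult P.m_comm)

lemma embed_poly_sum: "finite S \<Longrightarrow> embed_poly (sum f S) = (\<Oplus>\<^bsub>P\<^esub>k\<in>S. embed_poly (f k))"
  by (induction S rule: finite_induct) (simp_all add: embed_poly_0 embed_poly_add)

lemma embed_poly_of_int: "embed_poly (of_int c) = UnivPoly.monom P (embed c) 0"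
  by (rule up_eqI) (simp_all add: of_int_poly coeff_pCons embed_0 split: nat.split)

lemma embed_poly_X: "embed_poly X = indet p"
  unfolding indet_def
  by (rule up_eqI) (auto simp: X_def coeff_pCons embed_0 embed_1 split: nat.split)

text \<open>As products with an embedded constant, integer multiples fall under the rules for
  products; this covers the coefficients of the sums, the factors 2 and the generator p of the
  ideal.\<close>

lemma add_pow_eq_mult:
  assumes "z \<in> carrier P"
  shows "[k] \<cdot>\<^bsub>P\<^esub> z = embed_poly (of_nat k) \<otimes>\<^bsub>P\<^esub> z"
  using assms
  by (induction k)
    (simp_all add: P.add.nat_pow_0 P.add.nat_pow_Suc embed_poly_0 embed_poly_1 embed_poly_add P.l_distr P.a_comm)

section \<open>Congruence modulo p in \<open>\<int>\<^sub>p[\<beta>]\<close>\<close>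

lemma poly_cong_iff:
  "poly_cong p f g \<longleftrightarrow> f \<ominus>\<^bsub>P\<^esub> g \<in> PIdl\<^bsub>P\<^esub> (embed_poly (of_nat p))"
  by (simp add: poly_cong_def add_pow_eq_mult)

sublocale p_ideal: ideal "PIdl\<^bsub>padic_poly p\<^esub> (embed_poly (of_nat p))" "padic_poly p"
  by (rule P.cgenideal_ideal) simp

lemma poly_cong_refl [simp]: "f \<in> carrier P \<Longrightarrow> poly_cong p f f"
  using p_ideal.zero_closed by (simp add: poly_cong_iff a_minus_def P.r_neg)

lemma poly_cong_trans:
  assumes "f \<in> carrier P" "g \<in> carrier P" "h \<in> carrier P"
    and "poly_cong p f g" "poly_cong p g h"
  shows "poly_cong p f h"
proof -
  have "f \<ominus>\<^bsub>P\<^esub> h = (f \<ominus>\<^bsub>P\<^esub> g) \<oplus>\<^bsub>P\<^esub> (g \<ominus>\<^bsub>P\<^esub> h)"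
    using assms(1-3) by algebra
  then show ?thesis
    using assms(4,5) p_ideal.a_closed by (simp add: poly_cong_iff)
qed

lemma poly_cong_sym:
  assumes "f \<in> carrier P" "g \<in> carrier P" "poly_cong p f g"
  shows "poly_cong p g f"
proof -
  have "g \<ominus>\<^bsub>P\<^esub> f = \<ominus>\<^bsub>P\<^esub> (f \<ominus>\<^bsub>P\<^esub> g)"
    using assms(1,2) by algebra
  then show ?thesis
    using assms(3) p_ideal.a_inv_closed by (simp add: poly_cong_iff)
qed

lemma poly_cong_add:
  assumes "f \<in> carrier P" "g \<in> carrier P" "f' \<in> carrier P" "g' \<in> carrier P"
    and "poly_cong p f g" "poly_cong p f' g'"
  shows "poly_cong p (f \<oplus>\<^bsub>P\<^esub> f') (g \<oplus>\<^bsub>P\<^esub> g')"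
proof -
  have "(f \<oplus>\<^bsub>P\<^esub> f') \<ominus>\<^bsub>P\<^esub> (g \<oplus>\<^bsub>P\<^esub> g') = (f \<ominus>\<^bsub>P\<^esub> g) \<oplus>\<^bsub>P\<^esub> (f' \<ominus>\<^bsub>P\<^esub> g')"
    using assms(1-4) by algebra
  then show ?thesis
    using assms(5,6) p_ideal.a_closed by (simp add: poly_cong_iff)
qed

lemma poly_cong_mult:
  assumes "f \<in> carrier P" "g \<in> carrier P" "f' \<in> carrier P" "g' \<in> carrier P"
    and "poly_cong p f g" "poly_cong p f' g'"
  shows "poly_cong p (f \<otimes>\<^bsub>P\<^esub> f') (g \<otimes>\<^bsub>P\<^esub> g')"
proof -
  have "(f \<otimes>\<^bsub>P\<^esub> f') \<ominus>\<^bsub>P\<^esub> (g \<otimes>\<^bsub>P\<^esub> g') = (f \<ominus>\<^bsub>P\<^esub> g) \<otimes>\<^bsub>P\<^esub> f' \<oplus>\<^bsub>P\<^esub> g \<otimes>\<^bsub>P\<^esub> (f' \<ominus>\<^bsub>P\<^esub> g')"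
    using assms(1-4) by algebra
  then show ?thesis
    using assms p_ideal.a_closed p_ideal.I_l_closed p_ideal.I_r_closed by (simp add: poly_cong_iff)
qed

lemma poly_cong_finsum:
  assumes "finite S" "f \<in> S \<rightarrow> carrier P" "g \<in> S \<rightarrow> carrier P"
    and "\<And>k. k \<in> S \<Longrightarrow> poly_cong p (f k) (g k)"
  shows "poly_cong p (\<Oplus>\<^bsub>P\<^esub>k\<in>S. f k) (\<Oplus>\<^bsub>P\<^esub>k\<in>S. g k)"
  using assms
proof (induction S rule: finite_induct)
  case (insert k S)
  then have "poly_cong p (f k \<oplus>\<^bsub>P\<^esub> finsum P f S) (g k \<oplus>\<^bsub>P\<^esub> finsum P g S)"
    by (intro poly_cong_add P.finsum_closed insert.IH) auto
  then show ?case using insert by (simp add: P.finsum_insert)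
qed simp

lemma poly_cong_embed_poly:
  assumes "pcong p f g"
  shows "poly_cong p (embed_poly f) (embed_poly g)"
proof -
  have "of_nat p dvd f - g"
    using assms by (simp only: pcong_def)
  then obtain h where "f - g = of_nat p * h" by (rule dvdE)
  then have "f - g = h * of_nat p" by (simp only: mult.commute)
  then have "embed_poly f \<ominus>\<^bsub>P\<^esub> embed_poly g = embed_poly h \<otimes>\<^bsub>P\<^esub> embed_poly (of_nat p)"
    by (metis embed_poly_diff embed_poly_mult)
  then show ?thesis
    unfolding poly_cong_iff cgenideal_def by auto
qed

text \<open>Such a \<open>z\<close> is divisible by every power of \<open>X\<close>.\<close>

lemma eq_2X_mult_self_imp_0:
  assumes z: "z \<in> carrier P" and eq: "z = embed_poly (2 * X) \<otimes>\<^bsub>P\<^esub> z"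
  shows "z = \<zero>\<^bsub>P\<^esub>"
proof (rule up_eqI)
  fix n
  have pow: "z = embed_poly ((2 * X) ^ k) \<otimes>\<^bsub>P\<^esub> z" for k
  proof (induction k)
    case (Suc k)
    have "embed_poly ((2 * X) ^ Suc k) \<otimes>\<^bsub>P\<^esub> z = embed_poly ((2 * X) ^ k) \<otimes>\<^bsub>P\<^esub> (embed_poly (2 * X) \<otimes>\<^bsub>P\<^esub> z)"
      using z by (simp only: power_Suc2 embed_poly_mult[of "(2 * X) ^ k"] P.m_assoc embed_poly_closed)
    then show ?case using eq Suc by simp
  qed (simp add: embed_poly_1 z)
  \<comment> \<open>With exponent n + 1 all coefficients up to n vanish, so every term of the
    convolution for coefficient n of the product is 0.\<close>
  have "Polynomial.coeff ((2 * X) ^ Suc n) i = 0" if "i \<le> n" for i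
  proof -
    have "2 * X = Polynomial.monom 2 1"
      by (simp add: X_def numeral_poly monom_Suc monom_0)
    then show ?thesis
      using that by (simp only: monom_power Polynomial.coeff_monom) simp
  qed
  then have "(\<Oplus>\<^bsub>R\<^esub>i\<in>{..n}. embed (Polynomial.coeff ((2 * X) ^ Suc n) i) \<otimes>\<^bsub>R\<^esub> UnivPoly.coeff P z (n - i))
      = (\<Oplus>\<^bsub>R\<^esub>i\<in>{..n}. \<zero>\<^bsub>R\<^esub>)"
    using z by (intro R.finsum_cong') (auto simp: embed_0 simp del: power_Suc)
  moreover have "UnivPoly.coeff P z n = UnivPoly.coeff P (embed_poly ((2 * X) ^ Suc n) \<otimes>\<^bsub>P\<^esub> z) n"
    using pow[of "Suc n"] by simp
  ultimately show "UnivPoly.coeff P z n = UnivPoly.coeff P \<zero>\<^bsub>P\<^esub> n"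
    using z by (simp del: power_Suc)
qed (use z in auto)

end

locale padic_polys_gt_3 = prime_gt_3 p m for p m

sublocale padic_polys_gt_3 \<subseteq> padic_polys p
  using p_gt_3 by unfold_locales simp

context padic_polys_gt_3
begin

section \<open>Replacing p-adic inverses and harmonic numbers by integers modulo p\<close>

abbreviation const :: "(nat \<Rightarrow> int) \<Rightarrow> nat \<Rightarrow> nat \<Rightarrow> int"
  where "const u \<equiv> UnivPoly.monom P u 0"

text \<open>\<open>inv\<close> is meaningful only on units; for k below p the square of k is prime
  to p and hence a unit.\<close>

lemma inv_square_closed:
  assumes "1 \<le> k" "k < p"
  shows "inv_square p k \<in> carrier R" "inv_square p k \<otimes>\<^bsub>R\<^esub> embed (int (k ^ 2)) = \<one>\<^bsub>R\<^esub>"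
proof -
  have "coprime (k ^ 2) p"
    using coprime_p[OF assms] by simp
  then have "[(k ^ 2)] \<cdot>\<^bsub>R\<^esub> \<one>\<^bsub>R\<^esub> \<in> Units R"
    by (rule unit_padic_of_nat[OF p_pos])
  then show "inv_square p k \<in> carrier R" "inv_square p k \<otimes>\<^bsub>R\<^esub> embed (int (k ^ 2)) = \<one>\<^bsub>R\<^esub>"
    by (simp_all only: inv_square_def embed_of_nat R.Units_inv_closed R.Units_l_inv)
qed

text \<open>
  With \<open>K\<close> the constant \<open>1/k\<^sup>2\<close> and \<open>u\<close> an integer inverse of \<open>k\<close> modulo \<open>p\<close>: \<open>K \<equiv> K k\<^sup>2 u\<^sup>2 = u\<^sup>2\<close>.
\<close>

lemma const_inv_square:
  assumes "1 \<le> k" "k < p"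
  shows "poly_cong p (const (inv_square p k)) (embed_poly (of_int (inv_mod k ^ 2)))"
proof -
  let ?K = "const (inv_square p k)"
  have K: "?K \<in> carrier P" using inv_square_closed(1)[OF assms] by simp
  have "[(int k * inv_mod k) ^ 2 = 1 ^ 2] (mod int p)"
    by (intro cong_pow inv_mod_inverse assms)
  then have "pcong p 1 (of_int (int (k ^ 2)) * of_int (inv_mod k ^ 2))"
    using pcong_sym[OF pcong_of_int[of "(int k * inv_mod k) ^ 2" 1 p]] by (simp add: power_mult_distrib)
  then have "poly_cong p (?K \<otimes>\<^bsub>P\<^esub> \<one>\<^bsub>P\<^esub>)
      (?K \<otimes>\<^bsub>P\<^esub> (embed_poly (of_int (int (k ^ 2))) \<otimes>\<^bsub>P\<^esub> embed_poly (of_int (inv_mod k ^ 2))))"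
    unfolding embed_poly_1 [symmetric] embed_poly_mult [symmetric]
    using K by (intro poly_cong_mult poly_cong_embed_poly poly_cong_refl embed_poly_closed)
  also have "?K \<otimes>\<^bsub>P\<^esub> \<one>\<^bsub>P\<^esub> = ?K" using K by simp
  also have "?K \<otimes>\<^bsub>P\<^esub> (embed_poly (of_int (int (k ^ 2))) \<otimes>\<^bsub>P\<^esub> embed_poly (of_int (inv_mod k ^ 2)))
      = (?K \<otimes>\<^bsub>P\<^esub> embed_poly (of_int (int (k ^ 2)))) \<otimes>\<^bsub>P\<^esub> embed_poly (of_int (inv_mod k ^ 2))"
    using K by (simp only: P.m_assoc embed_poly_closed)
  also have "?K \<otimes>\<^bsub>P\<^esub> embed_poly (of_int (int (k ^ 2))) = \<one>\<^bsub>P\<^esub>"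
    unfolding embed_poly_of_int[of "int (k ^ 2)"]
    using inv_square_closed[OF assms] monom_mult[of "inv_square p k" "embed (int (k ^ 2))" 0 0]
    by (simp add: monom_one del: of_nat_power)
  finally show ?thesis by simp
qed

lemma padic_harmonic2_closed:
  assumes "k < p"
  shows "padic_harmonic2 p k \<in> carrier R"
  unfolding padic_harmonic2_def using assms
  by (intro R.finsum_closed) (auto intro!: inv_square_closed)

lemma const_padic_harmonic2:
  assumes "k < p"
  shows "poly_cong p (const (padic_harmonic2 p k)) (embed_poly (of_int (harmonic2 k)))"
proof -
  have closed: "(\<lambda>j. const (inv_square p j)) \<in> {1..k} \<rightarrow> carrier P"
    using assms by (auto intro!: monom_closed inv_square_closed)
  \<comment> \<open>Stated for subsets of {1..k}, so that the induction keeps every index below p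
    and every summand in the carrier.\<close>
  have "const (\<Oplus>\<^bsub>R\<^esub>j\<in>S. inv_square p j) = (\<Oplus>\<^bsub>P\<^esub>j\<in>S. const (inv_square p j))"
    if "S \<subseteq> {1..k}" for S
    using finite_subset[OF that finite_atLeastAtMost] that
  proof (induction S rule: finite_induct)
    case (insert j S)
    have S: "inv_square p \<in> insert j S \<rightarrow> carrier R"
      using insert.prems assms by (auto intro!: inv_square_closed)
    then have "(\<Oplus>\<^bsub>R\<^esub>j\<in>S. inv_square p j) \<in> carrier R"
      by (intro R.finsum_closed) auto
    moreover have "(\<lambda>j. const (inv_square p j)) \<in> S \<rightarrow> carrier P"
      using insert.prems closed by auto
    ultimately show ?case
      using insert S by (simp add: R.finsum_insert P.finsum_insert)
  qed simp_all
  then have "const (padic_harmonic2 p k) = (\<Oplus>\<^bsub>P\<^esub>j\<in>{1..k}. const (inv_square p j))"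
    by (simp add: padic_harmonic2_def)
  moreover have "poly_cong p (\<Oplus>\<^bsub>P\<^esub>j\<in>{1..k}. const (inv_square p j))
      (\<Oplus>\<^bsub>P\<^esub>j\<in>{1..k}. embed_poly (of_int (inv_mod j ^ 2)))"
    using closed assms by (intro poly_cong_finsum const_inv_square) auto
  moreover have "embed_poly (of_int (harmonic2 k)) = (\<Oplus>\<^bsub>P\<^esub>j\<in>{1..k}. embed_poly (of_int (inv_mod j ^ 2)))"
    by (simp add: harmonic2_def embed_poly_sum)
  ultimately show ?thesis by simp
qed

text \<open>The family \<open>f\<close> is left open: powers of t give the dilogarithms, and
  \<open>diff_quot\<close> gives the quotient.\<close>

lemma inv_square_sum_cong:
  "poly_cong p (\<Oplus>\<^bsub>P\<^esub>k\<in>{1..p-1}. const (inv_square p k) \<otimes>\<^bsub>P\<^esub> embed_poly (f k))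
    (embed_poly (\<Sum>k\<in>{1..p-1}. of_int (inv_mod k ^ 2) * f k))"
  unfolding embed_poly_sum[OF finite_atLeastAtMost] embed_poly_mult
  using p_gt_3 by (intro poly_cong_finsum poly_cong_mult const_inv_square)
    (auto intro!: P.m_closed monom_closed inv_square_closed)

lemma finite_polylog2_embed:
  "finite_polylog2 p (embed_poly t) = (\<Oplus>\<^bsub>P\<^esub>k\<in>{1..p-1}. const (inv_square p k) \<otimes>\<^bsub>P\<^esub> embed_poly (t ^ k))"
  unfolding finite_polylog2_def embed_poly_power
  using p_gt_3
  by (intro P.finsum_cong') (auto simp: monom_mult_is_smult inv_square_closed intro!: P.m_closed monom_closed)

lemma finite_polylog2_closed: "finite_polylog2 p (embed_poly t) \<in> carrier P"
  unfolding finite_polylog2_embed using p_gt_3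
  by (intro P.finsum_closed) (auto intro!: P.m_closed monom_closed inv_square_closed)

lemma finite_polylog2_cong: "poly_cong p (finite_polylog2 p (embed_poly t)) (embed_poly (polylog2 t))"
  unfolding finite_polylog2_embed polylog2_def by (rule inv_square_sum_cong)

text \<open>The coefficients \<open>c\<close> and exponents \<open>e\<close> are left open so that
  one statement serves the sums with binomials and with Catalan numbers.\<close>

lemma harmonic_sum_cong:
  "poly_cong p
    (\<Oplus>\<^bsub>P\<^esub>k\<in>{1..p-1}. [c k] \<cdot>\<^bsub>P\<^esub> (padic_harmonic2 p k \<odot>\<^bsub>P\<^esub> embed_poly y [^]\<^bsub>P\<^esub> (e k :: nat)))
    (embed_poly (\<Sum>k\<in>{1..p-1}. of_int (int (c k) * harmonic2 k) * y ^ e k))"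
proof -
  have eq: "[c k] \<cdot>\<^bsub>P\<^esub> (padic_harmonic2 p k \<odot>\<^bsub>P\<^esub> embed_poly y [^]\<^bsub>P\<^esub> e k)
      = embed_poly (of_nat (c k)) \<otimes>\<^bsub>P\<^esub> (const (padic_harmonic2 p k) \<otimes>\<^bsub>P\<^esub> embed_poly (y ^ e k))"
    if "k \<in> {1..p-1}" for k
    using that padic_harmonic2_closed[of k]
    by (subst add_pow_eq_mult) (auto simp: embed_poly_power monom_mult_is_smult simp flip: embed_poly_power)
  have "(\<Oplus>\<^bsub>P\<^esub>k\<in>{1..p-1}. [c k] \<cdot>\<^bsub>P\<^esub> (padic_harmonic2 p k \<odot>\<^bsub>P\<^esub> embed_poly y [^]\<^bsub>P\<^esub> e k))
     = (\<Oplus>\<^bsub>P\<^esub>k\<in>{1..p-1}. embed_poly (of_nat (c k)) \<otimes>\<^bsub>P\<^esub> (const (padic_harmonic2 p k) \<otimes>\<^bsub>P\<^esub> embed_poly (y ^ e k)))"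
    using padic_harmonic2_closed p_gt_3 by (intro P.finsum_cong' eq) (auto intro!: P.m_closed monom_closed)
  moreover have "embed_poly (\<Sum>k\<in>{1..p-1}. of_int (int (c k) * harmonic2 k) * y ^ e k)
     = (\<Oplus>\<^bsub>P\<^esub>k\<in>{1..p-1}. embed_poly (of_nat (c k)) \<otimes>\<^bsub>P\<^esub> (embed_poly (of_int (harmonic2 k)) \<otimes>\<^bsub>P\<^esub> embed_poly (y ^ e k)))"
    by (simp add: embed_poly_sum mult.assoc flip: embed_poly_mult)
  moreover have "poly_cong p
      (\<Oplus>\<^bsub>P\<^esub>k\<in>{1..p-1}. embed_poly (of_nat (c k)) \<otimes>\<^bsub>P\<^esub> (const (padic_harmonic2 p k) \<otimes>\<^bsub>P\<^esub> embed_poly (y ^ e k)))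
      (\<Oplus>\<^bsub>P\<^esub>k\<in>{1..p-1}. embed_poly (of_nat (c k)) \<otimes>\<^bsub>P\<^esub> (embed_poly (of_int (harmonic2 k)) \<otimes>\<^bsub>P\<^esub> embed_poly (y ^ e k)))"
    using padic_harmonic2_closed p_gt_3
    by (intro poly_cong_finsum poly_cong_mult const_padic_harmonic2)
      (auto intro!: P.m_closed monom_closed)
  ultimately show ?thesis by simp
qed

text \<open>A congruence does not suffice here: the definite description in
  \<open>exact_quot\<close> needs existence and uniqueness in the ring itself. Existence is termwise
  division by \<open>diff_quot_mult\<close>. For uniqueness, the difference z of two quotients
  satisfies (2 X - 1) z = 0, hence z = 2 X z, and \<open>eq_2X_mult_self_imp_0\<close>
  applies.\<close>

lemma exact_quot_polylog:
  "exact_quot P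
    ([(2::nat)] \<cdot>\<^bsub>P\<^esub> finite_polylog2 p (embed_poly (1 - X)) \<ominus>\<^bsub>P\<^esub> [(2::nat)] \<cdot>\<^bsub>P\<^esub> finite_polylog2 p (embed_poly X))
    (embed_poly (2 * X - 1))
  = (\<Oplus>\<^bsub>P\<^esub>k\<in>{1..p-1}. const (inv_square p k) \<otimes>\<^bsub>P\<^esub> embed_poly (diff_quot k))"
  (is "exact_quot P ?n ?d = ?Q")
  unfolding exact_quot_def
proof (rule the_equality)
  let ?S = "\<lambda>f. \<Oplus>\<^bsub>P\<^esub>k\<in>{1..p-1}. const (inv_square p k) \<otimes>\<^bsub>P\<^esub> embed_poly (f k)"
  have K: "const (inv_square p k) \<in> carrier P" if "k \<in> {1..p-1}" for k
    using that p_gt_3 by (auto intro!: monom_closed inv_square_closed)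
  have S_closed: "?S f \<in> carrier P" for f
    using K by (intro P.finsum_closed) auto
  have S_mult: "?S f \<otimes>\<^bsub>P\<^esub> embed_poly g = ?S (\<lambda>k. f k * g)" for f g
  proof -
    have "?S f \<otimes>\<^bsub>P\<^esub> embed_poly g
        = (\<Oplus>\<^bsub>P\<^esub>k\<in>{1..p-1}. const (inv_square p k) \<otimes>\<^bsub>P\<^esub> embed_poly (f k) \<otimes>\<^bsub>P\<^esub> embed_poly g)"
      using K by (intro P.finsum_ldistr) auto
    also have "\<dots> = ?S (\<lambda>k. f k * g)"
      using K by (intro P.finsum_cong') (auto simp: embed_poly_mult P.m_assoc)
    finally show ?thesis .
  qed
  have S_add: "?S f \<oplus>\<^bsub>P\<^esub> ?S g = ?S (\<lambda>k. f k + g k)" for f g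
  proof -
    have "?S f \<oplus>\<^bsub>P\<^esub> ?S g = (\<Oplus>\<^bsub>P\<^esub>k\<in>{1..p-1}. const (inv_square p k) \<otimes>\<^bsub>P\<^esub> embed_poly (f k)
        \<oplus>\<^bsub>P\<^esub> const (inv_square p k) \<otimes>\<^bsub>P\<^esub> embed_poly (g k))"
      using K by (intro P.finsum_addf [symmetric]) auto
    also have "\<dots> = ?S (\<lambda>k. f k + g k)"
      using K by (intro P.finsum_cong') (auto simp: embed_poly_add P.r_distr)
    finally show ?thesis .
  qed
  have two: "[(2::nat)] \<cdot>\<^bsub>P\<^esub> finite_polylog2 p (embed_poly t) = ?S (\<lambda>k. t ^ k * 2)" for t
    unfolding add_pow_eq_mult[OF finite_polylog2_closed] S_mult [symmetric]
    unfolding finite_polylog2_embed of_nat_numeral by (rule P.m_comm[OF embed_poly_closed S_closed])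
  \<comment> \<open>The subtrahend is first moved to the left, where \<open>S_mult\<close> and
    \<open>S_add\<close> suffice.\<close>
  have "?Q \<otimes>\<^bsub>P\<^esub> ?d \<oplus>\<^bsub>P\<^esub> ?S (\<lambda>k. X ^ k * 2) = ?S (\<lambda>k. (1 - X) ^ k * 2)"
    unfolding S_mult S_add diff_quot_mult by (simp add: mult.commute)
  moreover have "f = (f \<oplus>\<^bsub>P\<^esub> g) \<ominus>\<^bsub>P\<^esub> g" if "f \<in> carrier P" "g \<in> carrier P" for f g
    using that by algebra
  from this[OF P.m_closed[OF S_closed embed_poly_closed] S_closed]
  have "?Q \<otimes>\<^bsub>P\<^esub> ?d = (?Q \<otimes>\<^bsub>P\<^esub> ?d \<oplus>\<^bsub>P\<^esub> ?S (\<lambda>k. X ^ k * 2)) \<ominus>\<^bsub>P\<^esub> ?S (\<lambda>k. X ^ k * 2)" .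
  ultimately have "?Q \<otimes>\<^bsub>P\<^esub> ?d = ?S (\<lambda>k. (1 - X) ^ k * 2) \<ominus>\<^bsub>P\<^esub> ?S (\<lambda>k. X ^ k * 2)"
    by (simp only:)
  then have Q: "?Q \<otimes>\<^bsub>P\<^esub> ?d = ?n" by (simp only: two)
  show "?Q \<in> carrier P \<and> ?Q \<otimes>\<^bsub>P\<^esub> ?d = ?n"
    using Q S_closed by simp
  fix q assume q: "q \<in> carrier P \<and> q \<otimes>\<^bsub>P\<^esub> ?d = ?n"
  define z where "z = q \<ominus>\<^bsub>P\<^esub> ?Q"
  have z: "z \<in> carrier P" using q S_closed by (simp add: z_def)
  have d: "?d = embed_poly (2 * X) \<ominus>\<^bsub>P\<^esub> \<one>\<^bsub>P\<^esub>"
    by (simp add: embed_poly_diff embed_poly_1)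
  have "(f \<ominus>\<^bsub>P\<^esub> g) \<otimes>\<^bsub>P\<^esub> h = f \<otimes>\<^bsub>P\<^esub> h \<ominus>\<^bsub>P\<^esub> g \<otimes>\<^bsub>P\<^esub> h"
    if "f \<in> carrier P" "g \<in> carrier P" "h \<in> carrier P" for f g h
    using that by algebra
  from this[OF conjunct1[OF q] S_closed embed_poly_closed]
  have "z \<otimes>\<^bsub>P\<^esub> ?d = ?n \<ominus>\<^bsub>P\<^esub> ?n"
    by (simp only: z_def q Q)
  also have "\<dots> = \<zero>\<^bsub>P\<^esub>"
    unfolding Q [symmetric] by (simp only: P.r_right_minus_eq P.m_closed S_closed embed_poly_closed)
  also have "z \<otimes>\<^bsub>P\<^esub> ?d = embed_poly (2 * X) \<otimes>\<^bsub>P\<^esub> z \<ominus>\<^bsub>P\<^esub> z"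
    unfolding d using z embed_poly_closed[of "2 * X"] P.one_closed by algebra
  finally have "embed_poly (2 * X) \<otimes>\<^bsub>P\<^esub> z = z"
    by (simp only: P.r_right_minus_eq P.m_closed z embed_poly_closed)
  then have "z = embed_poly (2 * X) \<otimes>\<^bsub>P\<^esub> z" ..
  with z have "z = \<zero>\<^bsub>P\<^esub>" by (rule eq_2X_mult_self_imp_0)
  then show "q = ?Q"
    using q S_closed by (simp add: z_def)
qed

section \<open>Both congruences in \<open>\<int>\<^sub>p[\<beta>]\<close>\<close>

lemma polylog_congruences:
  defines "\<beta> \<equiv> embed_poly X" and "\<alpha> \<equiv> embed_poly (1 - X)"
  shows "poly_cong p
           (\<Oplus>\<^bsub>P\<^esub>k\<in>{1..p-1}. [((2 * k) choose k)] \<cdot>\<^bsub>P\<^esub> (padic_harmonic2 p k \<odot>\<^bsub>P\<^esub> embed_poly x [^]\<^bsub>P\<^esub> k))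
           (exact_quot P
              ([(2::nat)] \<cdot>\<^bsub>P\<^esub> finite_polylog2 p \<alpha> \<ominus>\<^bsub>P\<^esub> [(2::nat)] \<cdot>\<^bsub>P\<^esub> finite_polylog2 p \<beta>)
              (\<beta> \<ominus>\<^bsub>P\<^esub> \<alpha>))" (is "poly_cong p ?l1 ?r1")
    and "poly_cong p
           (\<Oplus>\<^bsub>P\<^esub>k\<in>{1..p-1}. [catalan k] \<cdot>\<^bsub>P\<^esub> (padic_harmonic2 p k \<odot>\<^bsub>P\<^esub> embed_poly x [^]\<^bsub>P\<^esub> (k + 1)))
           ([(2::nat)] \<cdot>\<^bsub>P\<^esub> (\<alpha> \<otimes>\<^bsub>P\<^esub> finite_polylog2 p \<alpha>) \<oplus>\<^bsub>P\<^esub> [(2::nat)] \<cdot>\<^bsub>P\<^esub> (\<beta> \<otimes>\<^bsub>P\<^esub> finite_polylog2 p \<beta>))"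
      (is "poly_cong p ?l2 ?r2")
proof -
  have closed: "(\<Oplus>\<^bsub>P\<^esub>k\<in>{1..p-1}. [c k] \<cdot>\<^bsub>P\<^esub> (padic_harmonic2 p k \<odot>\<^bsub>P\<^esub> embed_poly x [^]\<^bsub>P\<^esub> (e k :: nat))) \<in> carrier P"
    for c e :: "nat \<Rightarrow> nat"
    using p_gt_3
    by (intro P.finsum_closed Pi_I P.add.nat_pow_closed UP_smult_closed P.nat_pow_closed
        embed_poly_closed padic_harmonic2_closed) auto
  have "\<beta> \<ominus>\<^bsub>P\<^esub> \<alpha> = embed_poly (2 * X - 1)"
    by (simp add: \<alpha>_def \<beta>_def flip: embed_poly_diff)
  then have r1: "?r1 = (\<Oplus>\<^bsub>P\<^esub>k\<in>{1..p-1}. const (inv_square p k) \<otimes>\<^bsub>P\<^esub> embed_poly (diff_quot k))"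
    unfolding \<alpha>_def \<beta>_def by (simp only: exact_quot_polylog)
  have r1_closed: "?r1 \<in> carrier P"
    unfolding r1 using p_gt_3
    by (intro P.finsum_closed) (auto intro!: P.m_closed monom_closed inv_square_closed)
  \<comment> \<open>Each side of the goal is congruent to the embedding of an integer polynomial;
    this step compares those two polynomials.\<close>
  have "pcong p (\<Sum>k\<in>{1..p-1}. of_int (cbinom k * harmonic2 k) * x ^ k)
      (\<Sum>k\<in>{1..p-1}. of_int (inv_mod k ^ 2) * diff_quot k)"
    using harmonic_poly_extend harmonic_poly_quotient by (rule pcong_trans)
  then have "poly_cong p ?l1 (embed_poly (\<Sum>k\<in>{1..p-1}. of_int (inv_mod k ^ 2) * diff_quot k))"
    unfolding cbinom_def
    by (rule poly_cong_trans[OF closed embed_poly_closed embed_poly_closed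
          harmonic_sum_cong poly_cong_embed_poly])
  moreover have "poly_cong p (embed_poly (\<Sum>k\<in>{1..p-1}. of_int (inv_mod k ^ 2) * diff_quot k)) ?r1"
    unfolding r1 using r1_closed
    by (intro poly_cong_sym[OF _ embed_poly_closed inv_square_sum_cong]) (simp only: r1)
  ultimately show "poly_cong p ?l1 ?r1"
    by (rule poly_cong_trans[OF closed embed_poly_closed r1_closed])
  have r2: "?r2 = embed_poly 2 \<otimes>\<^bsub>P\<^esub> (\<alpha> \<otimes>\<^bsub>P\<^esub> finite_polylog2 p \<alpha>) \<oplus>\<^bsub>P\<^esub> embed_poly 2 \<otimes>\<^bsub>P\<^esub> (\<beta> \<otimes>\<^bsub>P\<^esub> finite_polylog2 p \<beta>)"
    by (simp add: add_pow_eq_mult \<alpha>_def \<beta>_def finite_polylog2_closed)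
  have r2_closed: "?r2 \<in> carrier P"
    unfolding r2 by (simp add: \<alpha>_def \<beta>_def finite_polylog2_closed)
  have "poly_cong p ?r2 (embed_poly (2 * ((1 - X) * polylog2 (1 - X)) + 2 * (X * polylog2 X)))"
    unfolding r2 unfolding embed_poly_add embed_poly_mult \<alpha>_def \<beta>_def
    by (intro poly_cong_add poly_cong_mult poly_cong_refl finite_polylog2_cong P.m_closed
        embed_poly_closed finite_polylog2_closed)
  then have "poly_cong p (embed_poly (2 * ((1 - X) * polylog2 (1 - X)) + 2 * (X * polylog2 X))) ?r2"
    by (rule poly_cong_sym[OF r2_closed embed_poly_closed])
  moreover have "poly_cong p ?l2 (embed_poly (2 * ((1 - X) * polylog2 (1 - X)) + 2 * (X * polylog2 X)))"
    using harmonic_sum_cong[of catalan x "\<lambda>k. k + 1"]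
      poly_cong_embed_poly[OF pcong_trans[OF catalan_poly_extend catalan_poly_polylog]]
    by (rule poly_cong_trans[OF closed embed_poly_closed embed_poly_closed])
  ultimately show "poly_cong p ?l2 ?r2"
    by (rule poly_cong_trans[OF closed embed_poly_closed r2_closed, rotated])
qed

end

theorem theorem7p3:
  fixes p :: nat and P (structure) and \<alpha> \<beta> x :: "nat \<Rightarrow> nat \<Rightarrow> int"
  assumes "prime p" and "p > 3"
  defines "P \<equiv> padic_poly p"
    and "\<beta> \<equiv> indet p"
    and "\<alpha> \<equiv> \<one> \<ominus> \<beta>"
    and "x \<equiv> \<beta> \<otimes> (\<one> \<ominus> \<beta>)"
  shows "poly_cong p
           (\<Oplus>k\<in>{1..p-1}. [((2 * k) choose k)] \<cdot> (padic_harmonic2 p k \<odot> x [^] k))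
           (exact_quot P
              ([(2::nat)] \<cdot> finite_polylog2 p \<alpha> \<ominus> [(2::nat)] \<cdot> finite_polylog2 p \<beta>)
              (\<beta> \<ominus> \<alpha>)) \<and>
         poly_cong p
           (\<Oplus>k\<in>{1..p-1}. [catalan k] \<cdot> (padic_harmonic2 p k \<odot> x [^] (k + 1)))
           ([(2::nat)] \<cdot> (\<alpha> \<otimes> finite_polylog2 p \<alpha>) \<oplus> [(2::nat)] \<cdot> (\<beta> \<otimes> finite_polylog2 p \<beta>))"
proof -
  note P_eq = P_def
  have "odd p"
    using assms(1,2) by (intro prime_odd_nat) auto
  then obtain m where "p = 2 * m + 1" by (elim oddE)
  then interpret padic_polys_gt_3 p m
    using assms(1,2) by unfold_locales
  have \<beta>: "\<beta> = embed_poly X"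
    by (simp add: \<beta>_def embed_poly_X)
  have \<alpha>: "\<alpha> = embed_poly (1 - X)"
    by (simp add: \<alpha>_def \<beta>_def P_eq embed_poly_diff embed_poly_1 embed_poly_X)
  have x: "x = embed_poly (X * (1 - X))"
    by (simp add: x_def \<beta>_def P_eq embed_poly_mult embed_poly_diff embed_poly_1 embed_poly_X)
  show ?thesis
    unfolding x \<alpha> \<beta> P_eq by (rule conjI[OF polylog_congruences])
qed

end
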